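(* Fix $\alpha\in\{\text{rotor routing},\ \text{Bernardi}\}$, and for a ribbon graph $(H,\sigma)$ and $u\in V(H)$ write $\alpha_u^{H}$ for the corresponding sandpile torsor with basepoint $u$. There exist ribbon graphs $(G,\rho)$ and $(G',\rho')$ of genera $g\neq g'$ with $V(G)=V(G')$, a subset $V_{gen}\subseteq V(G)$ satisfying Properties 1 and 2 below, and a bijection $\varphi:\mathcal T(G)\to\mathcal T(G')$ such that, with $\hat\gamma:\operatorname{Pic}^0(G)\to\operatorname{Pic}^0(G')$ the isomorphism induced by the identity on $V_{gen}$, for every $v\in V(G)$, $S\in\operatorname{Pic}^0(G)$, $T\in\mathcal T(G)$: $$\varphi\big(\alpha_v^{G}(S,T)\big)=\alpha_v^{G'}\big(\hat\gamma(S),\varphi(T)\big).$$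
   Context: Graphs are finite and connected, may have multiple edges, and have no loops. $\mathcal T(G)$ is the set of spanning trees (subsets of $E(G)$). A ribbon graph $(G,\rho)$ assigns to each vertex $u$ a cyclic order $\rho_u$ on the edges incident to $u$. $\operatorname{Div}^0(G)$: integer chip configurations of total degree 0; firing $u$ moves one chip from $u$ along each incident edge; $\operatorname{Pic}^0(G)$ is $\operatorname{Div}^0(G)$ modulo the subgroup generated by firings (the image of the Laplacian); $\operatorname{Pic}^k(G)$ is defined likewise for degree $k$. For graphs $G,G'$ on the same vertex set and $V_{gen}\subseteq V(G)$: Property 1: every element of $\operatorname{Pic}^0(G)$ and every element of $\operatorname{Pic}^0(G')$ has a representative with no chips outside $V_{gen}$. Property 2: two degree-zero configurations with no chips outside $V_{gen}$ are equivalent in $G$ iff they are equivalent in $G'$. Then $\hat\gamma(S)$ is defined by choosing a representative of $S$ supported on $V_{gen}$ and taking its class in $\operatorname{Pic}^0(G')$ (same chip counts on each vertex). Rotor routing torsor $r_v$: for $S\in\operatorname{Pic}^0(G)$, $T\in\mathcal T(G)$, choose a representative of $S$ nonnegative away from $v$; orient $T$ towards $v$ so each $u\ne v$ has an outgoing edge (rotor). While some $u\neq v$ has positive chips, advance the rotor at $u$ to the next edge of $\rho_u$ and send a chip from $u$ along it. When all vertices other than $v$ have zero chips, the rotors form the spanning tree $r_v(S,T)$ (well defined; a free transitive action). Bernardi torsor $\beta_v$: with half-edges $(e,u)$ for $u$ an endpoint of $e$, for $T\in\mathcal T(G)$ start at $(e_0,v)$ for a fixed edge $e_0$ at $v$;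 at $(e',v')$: if $e'\in T$ with other endpoint $w'$, move to $(e'',w')$, $e''$ following $e'$ in $\rho_{w'}$; if $e'\notin T$, move to $(\tilde e,v')$, $\tilde e$ following $e'$ in $\rho_{v'}$, placing a chip on $v'$ if the other half-edge of $e'$ was not yet visited. Stop on returning to $(e_0,v)$. The resulting divisors $D_T$ of degree $k=|E|-|V|+1$ give a bijection $T\mapsto[D_T]\in\operatorname{Pic}^k(G)$, and $\beta_v(S,T)$ is the unique $T'$ with $[D_{T'}]=[D_T]+S$. Genus: a cycle of $(G,\rho)$ is a closed walk that, on entering $u$ along $e$, leaves along the edge following $e$ in $\rho_u$; with $\operatorname{cyc}(G,\rho)$ the number of cycles, the genus $g$ satisfies $2g=2-|V(G)|+|E(G)|-\operatorname{cyc}(G,\rho)$. *)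

theory Defs
  imports Complex_Main
begin

record ('v, 'e) mgraph =
  verts :: "'v set"
  edges :: "'e set"
  ends  :: "'e \<Rightarrow> 'v \<times> 'v"

definition incident :: "('v, 'e) mgraph \<Rightarrow> 'e \<Rightarrow> 'v \<Rightarrow> bool" where
  "incident G e u \<longleftrightarrow> e \<in> edges G \<and> (u = fst (ends G e) \<or> u = snd (ends G e))"

definition other :: "('v, 'e) mgraph \<Rightarrow> 'e \<Rightarrow> 'v \<Rightarrow> 'v" where
  "other G e u = (if u = fst (ends G e) then snd (ends G e) else fst (ends G e))"

definition connected_via :: "('v, 'e) mgraph \<Rightarrow> 'e set \<Rightarrow> bool" where
  "connected_via G F \<longleftrightarrow>
     (\<forall>u\<in>verts G. \<forall>w\<in>verts G.
        (\<lambda>x y. \<exists>e\<in>F. incident G e x \<and> y = other G e x)\<^sup>*\<^sup>* u w)"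

definition graph :: "('v, 'e) mgraph \<Rightarrow> bool" where
  "graph G \<longleftrightarrow> finite (verts G) \<and> verts G \<noteq> {} \<and> finite (edges G) \<and>
     (\<forall>e\<in>edges G. fst (ends G e) \<in> verts G \<and> snd (ends G e) \<in> verts G \<and>
                   fst (ends G e) \<noteq> snd (ends G e)) \<and>
     connected_via G (edges G)"

definition ribbon :: "('v, 'e) mgraph \<Rightarrow> ('v \<Rightarrow> 'e \<Rightarrow> 'e) \<Rightarrow> bool" where
  "ribbon G rho \<longleftrightarrow> graph G \<and>
     (\<forall>u\<in>verts G. bij_betw (rho u) {e. incident G e u} {e. incident G e u} \<and>
        (\<forall>e\<in>{e. incident G e u}. \<forall>e'\<in>{e. incident G e u}. \<exists>n. (rho u ^^ n) e = e'))"

definition spanning_trees :: "('v, 'e) mgraph \<Rightarrow> 'e set set" where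
  "spanning_trees G = {T. T \<subseteq> edges G \<and> connected_via G T \<and>
                          (\<forall>e\<in>T. \<not> connected_via G (T - {e}))}"

definition is_div :: "('v, 'e) mgraph \<Rightarrow> ('v \<Rightarrow> int) \<Rightarrow> bool" where
  "is_div G D \<longleftrightarrow> (\<forall>u. u \<notin> verts G \<longrightarrow> D u = 0)"

definition Div0 :: "('v, 'e) mgraph \<Rightarrow> ('v \<Rightarrow> int) set" where
  "Div0 G = {D. is_div G D \<and> (\<Sum>u\<in>verts G. D u) = 0}"

definition vdeg :: "('v, 'e) mgraph \<Rightarrow> 'v \<Rightarrow> nat" where
  "vdeg G u = card {e. incident G e u}"

definition fire :: "('v, 'e) mgraph \<Rightarrow> 'v \<Rightarrow> 'v \<Rightarrow> int" where
  "fire G u w = (if w = u then - int (vdeg G u)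
                 else int (card {e. incident G e u \<and> incident G e w}))"

definition lin_equiv :: "('v, 'e) mgraph \<Rightarrow> ('v \<Rightarrow> int) \<Rightarrow> ('v \<Rightarrow> int) \<Rightarrow> bool" where
  "lin_equiv G D D' \<longleftrightarrow>
     (\<exists>f :: 'v \<Rightarrow> int. \<forall>w. D' w = D w + (\<Sum>u\<in>verts G. f u * fire G u w))"

definition lin_class :: "('v, 'e) mgraph \<Rightarrow> ('v \<Rightarrow> int) \<Rightarrow> ('v \<Rightarrow> int) set" where
  "lin_class G D = {D'. is_div G D' \<and> lin_equiv G D D'}"

definition Pic0 :: "('v, 'e) mgraph \<Rightarrow> ('v \<Rightarrow> int) set set" where
  "Pic0 G = lin_class G ` Div0 G"

definition supported_in :: "'v set \<Rightarrow> ('v \<Rightarrow> int) \<Rightarrow> bool" where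
  "supported_in A D \<longleftrightarrow> (\<forall>u. u \<notin> A \<longrightarrow> D u = 0)"

definition property1 :: "('v, 'e) mgraph \<Rightarrow> ('v, 'e) mgraph \<Rightarrow> 'v set \<Rightarrow> bool" where
  "property1 G G' Vgen \<longleftrightarrow>
     (\<forall>S\<in>Pic0 G. \<exists>D\<in>S. supported_in Vgen D) \<and>
     (\<forall>S\<in>Pic0 G'. \<exists>D\<in>S. supported_in Vgen D)"

definition property2 :: "('v, 'e) mgraph \<Rightarrow> ('v, 'e) mgraph \<Rightarrow> 'v set \<Rightarrow> bool" where
  "property2 G G' Vgen \<longleftrightarrow>
     (\<forall>D\<in>Div0 G. \<forall>D'\<in>Div0 G. supported_in Vgen D \<longrightarrow> supported_in Vgen D' \<longrightarrow>
        (lin_equiv G D D' \<longleftrightarrow> lin_equiv G' D D'))"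

definition gamma_hat ::
  "('v, 'e) mgraph \<Rightarrow> ('v, 'e) mgraph \<Rightarrow> 'v set \<Rightarrow> ('v \<Rightarrow> int) set \<Rightarrow> ('v \<Rightarrow> int) set" where
  "gamma_hat G G' Vgen S = lin_class G' (SOME D. D \<in> S \<and> supported_in Vgen D)"

definition rr_step ::
  "('v, 'e) mgraph \<Rightarrow> ('v \<Rightarrow> 'e \<Rightarrow> 'e) \<Rightarrow> 'v \<Rightarrow>
   ('v \<Rightarrow> int) \<times> ('v \<Rightarrow> 'e) \<Rightarrow> ('v \<Rightarrow> int) \<times> ('v \<Rightarrow> 'e) \<Rightarrow> bool" where
  "rr_step G rho v s s' \<longleftrightarrow>
     (\<exists>u\<in>verts G - {v}. fst s u > 0 \<and>
        snd s' = (snd s)(u := rho u (snd s u)) \<and>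
        fst s' = (\<lambda>x. fst s x - (if x = u then 1 else 0)
                      + (if x = other G (snd s' u) u then 1 else 0)))"

definition oriented_to :: "('v, 'e) mgraph \<Rightarrow> 'e set \<Rightarrow> 'v \<Rightarrow> ('v \<Rightarrow> 'e) \<Rightarrow> bool" where
  "oriented_to G T v rot \<longleftrightarrow>
     (\<forall>u\<in>verts G - {v}. rot u \<in> T \<and> incident G (rot u) u \<and>
        (\<exists>n. ((\<lambda>x. other G (rot x) x) ^^ n) u = v))"

definition rr_result ::
  "('v, 'e) mgraph \<Rightarrow> ('v \<Rightarrow> 'e \<Rightarrow> 'e) \<Rightarrow> 'v \<Rightarrow> ('v \<Rightarrow> int) set \<Rightarrow> 'e set \<Rightarrow> 'e set \<Rightarrow> bool" where
  "rr_result G rho v S T T' \<longleftrightarrow>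
     (\<exists>D rot D' rot'. D \<in> S \<and> (\<forall>u\<in>verts G - {v}. 0 \<le> D u) \<and> oriented_to G T v rot \<and>
        (rr_step G rho v)\<^sup>*\<^sup>* (D, rot) (D', rot') \<and>
        (\<forall>u\<in>verts G - {v}. D' u = 0) \<and> T' = rot' ` (verts G - {v}))"

definition rotor_torsor ::
  "('v, 'e) mgraph \<Rightarrow> ('v \<Rightarrow> 'e \<Rightarrow> 'e) \<Rightarrow> 'v \<Rightarrow> ('v \<Rightarrow> int) set \<Rightarrow> 'e set \<Rightarrow> 'e set" where
  "rotor_torsor G rho v S T = (THE T'. rr_result G rho v S T T')"

definition bstep :: "('v, 'e) mgraph \<Rightarrow> ('v \<Rightarrow> 'e \<Rightarrow> 'e) \<Rightarrow> 'e set \<Rightarrow> 'e \<times> 'v \<Rightarrow> 'e \<times> 'v" where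
  "bstep G rho T h = (if fst h \<in> T
      then (rho (other G (fst h) (snd h)) (fst h), other G (fst h) (snd h))
      else (rho (snd h) (fst h), snd h))"

definition btour :: "('v, 'e) mgraph \<Rightarrow> ('v \<Rightarrow> 'e \<Rightarrow> 'e) \<Rightarrow> 'e set \<Rightarrow> 'v \<Rightarrow> 'e \<Rightarrow> nat \<Rightarrow> 'e \<times> 'v" where
  "btour G rho T v e0 n = (bstep G rho T ^^ n) (e0, v)"

definition blen :: "('v, 'e) mgraph \<Rightarrow> ('v \<Rightarrow> 'e \<Rightarrow> 'e) \<Rightarrow> 'e set \<Rightarrow> 'v \<Rightarrow> 'e \<Rightarrow> nat" where
  "blen G rho T v e0 = (LEAST n. 0 < n \<and> btour G rho T v e0 n = (e0, v))"

definition bdiv :: "('v, 'e) mgraph \<Rightarrow> ('v \<Rightarrow> 'e \<Rightarrow> 'e) \<Rightarrow> 'v \<Rightarrow> 'e \<Rightarrow> 'e set \<Rightarrow> 'v \<Rightarrow> int" where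
  "bdiv G rho v e0 T u = int (card {i. i < blen G rho T v e0 \<and>
      snd (btour G rho T v e0 i) = u \<and> fst (btour G rho T v e0 i) \<notin> T \<and>
      (fst (btour G rho T v e0 i), other G (fst (btour G rho T v e0 i)) u)
         \<notin> btour G rho T v e0 ` {..<i}})"

definition bernardi_torsor ::
  "('v, 'e) mgraph \<Rightarrow> ('v \<Rightarrow> 'e \<Rightarrow> 'e) \<Rightarrow> 'v \<Rightarrow> 'e \<Rightarrow> ('v \<Rightarrow> int) set \<Rightarrow> 'e set \<Rightarrow> 'e set" where
  "bernardi_torsor G rho v e0 S T = (THE T'. T' \<in> spanning_trees G \<and>
      (\<exists>D\<in>S. lin_equiv G (\<lambda>u. bdiv G rho v e0 T u + D u) (bdiv G rho v e0 T')))"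

definition half_edges :: "('v, 'e) mgraph \<Rightarrow> ('e \<times> 'v) set" where
  "half_edges G = {(e, u). incident G e u}"

text \<open>Having entered u along e, leave along rho u e.\<close>
definition face_next :: "('v, 'e) mgraph \<Rightarrow> ('v \<Rightarrow> 'e \<Rightarrow> 'e) \<Rightarrow> 'e \<times> 'v \<Rightarrow> 'e \<times> 'v" where
  "face_next G rho h = (rho (snd h) (fst h), other G (rho (snd h) (fst h)) (snd h))"

definition cyc :: "('v, 'e) mgraph \<Rightarrow> ('v \<Rightarrow> 'e \<Rightarrow> 'e) \<Rightarrow> nat" where
  "cyc G rho = card (half_edges G //
     {(h, h'). h \<in> half_edges G \<and> h' \<in> half_edges G \<and> (\<exists>n. (face_next G rho ^^ n) h = h')})"

definition genus :: "('v, 'e) mgraph \<Rightarrow> ('v \<Rightarrow> 'e \<Rightarrow> 'e) \<Rightarrow> real" where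
  "genus G rho = (2 - real (card (verts G)) + real (card (edges G)) - real (cyc G rho)) / 2"

end

theory Submission
  imports Defs
begin

text \<open>
  The graph \<open>star p q\<close> has a center 0 joined to vertex 1 by p edges and to vertex 2 by q edges, with the
  edges cyclically ordered by their numbers at every vertex. Its spanning trees are the pairs
  \<open>{i, p + j}\<close>, and its Picard group is \<open>\<int>/p \<times> \<int>/q\<close>, read off from the chips at the two leaves.
  With basepoint at the center, both torsors act by translating (i, j) by the class of the divisor
  (up to a global sign for the Bernardi torsor); moving the basepoint to a leaf only reverses the
  sign of the coordinate of that leaf. For \<open>star 3 2\<close>, of genus 1, and \<open>star 6 1\<close>, of genus 2, both groups
  are cyclic of order 6 and generated by the difference of the two leaves. The sign of the
  second coordinate is irrelevant modulo 2 and modulo 1, so the Chinese remainder theorem identifies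
  the two families of actions.
\<close>

subsection \<open>Star ribbon graphs\<close>

text \<open>The edges at each leaf carry consecutive numbers, so one turn of the center rotor serves
  leaf 1 \<open>p\<close> times and then leaf 2 \<open>q\<close> times.\<close>

definition star :: "nat \<Rightarrow> nat \<Rightarrow> (nat, nat) mgraph" where
  "star p q = \<lparr>verts = {0, 1, 2}, edges = {..<p + q}, ends = (\<lambda>e. (0, if e < p then 1 else 2))\<rparr>"

text \<open>For positive \<open>p\<close> and \<open>q\<close> the value is an edge at the vertex
  \<open>u\<close> even when \<open>e\<close> is not one, which bounds every advanced rotor.\<close>

definition srot :: "nat \<Rightarrow> nat \<Rightarrow> nat \<Rightarrow> nat \<Rightarrow> nat" where
  "srot p q u e = (if u = 0 then (e + 1) mod (p + q)
                   else if u = 1 then (e + 1) mod p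
                   else p + (e - p + 1) mod q)"

lemma verts_star [simp]: "verts (star p q) = {0, 1, 2}"
  and edges_star [simp]: "edges (star p q) = {..<p + q}"
  and ends_star [simp]: "ends (star p q) e = (0, if e < p then 1 else 2)"
  by (simp_all add: star_def)

lemma incident_star:
  "incident (star p q) e u \<longleftrightarrow>
     (u = 0 \<and> e < p + q) \<or> (u = 1 \<and> e < p) \<or> (u = 2 \<and> p \<le> e \<and> e < p + q)"
  by (auto simp: incident_def)

lemma incident_star_0: "{e. incident (star p q) e 0} = {..<p + q}"
  and incident_star_1: "{e. incident (star p q) e 1} = {..<p}"
  and incident_star_2: "{e. incident (star p q) e 2} = {p..<p + q}"
  by (auto simp: incident_star)

lemma other_star: "other (star p q) e u = (if u = 0 then if e < p then 1 else 2 else 0)"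
  by (simp add: other_def)

lemma other_star_simps [simp]:
  "other (star p q) e 0 = (if e < p then 1 else 2)"
  "other (star p q) e (Suc 0) = 0"
  "other (star p q) e 2 = 0"
  by (simp_all add: other_star)

lemma connected_via_star_iff:
  assumes F: "F \<subseteq> {..<p + q}"
  shows "connected_via (star p q) F \<longleftrightarrow> (\<exists>e\<in>F. e < p) \<and> (\<exists>e\<in>F. p \<le> e)"
proof -
  let ?R = "\<lambda>x y. \<exists>e\<in>F. incident (star p q) e x \<and> y = other (star p q) e x"
  show ?thesis
  proof
    assume c: "connected_via (star p q) F"
    have "?R\<^sup>*\<^sup>* 1 0" "?R\<^sup>*\<^sup>* 2 0"
      using c by (auto simp: connected_via_def)
    \<comment> \<open>A path from a leaf to the center is nonempty, so its first step uses an edge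
      of \<open>F\<close> at that leaf.\<close>
    then have "\<exists>y. ?R 1 y" "\<exists>y. ?R 2 y"
      by (auto elim: converse_rtranclpE)
    then show "(\<exists>e\<in>F. e < p) \<and> (\<exists>e\<in>F. p \<le> e)"
      by (auto simp: incident_star)
  next
    assume "(\<exists>e\<in>F. e < p) \<and> (\<exists>e\<in>F. p \<le> e)"
    then obtain a b where ab: "a \<in> F" "a < p" "b \<in> F" "p \<le> b" "b < p + q"
      using F by auto
    have step: "?R 0 1" "?R 1 0" "?R 0 2" "?R 2 0"
      by (rule bexI[OF _ ab(1)] bexI[OF _ ab(3)], use ab in \<open>simp add: incident_star other_star\<close>)+
    have to: "?R\<^sup>*\<^sup>* u 0" if "u \<in> {0, 1, 2}" for u
      using that step by blast
    have fro: "?R\<^sup>*\<^sup>* 0 w" if "w \<in> {0, 1, 2}" for w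
      using that step by blast
    show "connected_via (star p q) F"
      unfolding connected_via_def verts_star
      using to fro rtranclp_trans[of ?R] by blast
  qed
qed

lemma spanning_trees_star:
  "spanning_trees (star p q) = {{i, p + j} | i j. i < p \<and> j < q}"
proof (intro equalityI subsetI)
  fix T assume "T \<in> spanning_trees (star p q)"
  then have T: "T \<subseteq> {..<p + q}" "connected_via (star p q) T"
    and min: "\<And>e. e \<in> T \<Longrightarrow> \<not> connected_via (star p q) (T - {e})"
    by (auto simp: spanning_trees_def)
  from T obtain a b where ab: "a \<in> T" "a < p" "b \<in> T" "p \<le> b" "b < p + q"
    using connected_via_star_iff[OF T(1)] by auto
  \<comment> \<open>Any third edge could be deleted without cutting off a leaf, against
    minimality.\<close>
  have "e = a \<or> e = b" if e: "e \<in> T" for e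
  proof (rule ccontr)
    assume ne: "\<not> (e = a \<or> e = b)"
    have "T - {e} \<subseteq> {..<p + q}" using T(1) by auto
    moreover have "a \<in> T - {e}" "b \<in> T - {e}" using ab ne by auto
    ultimately have "connected_via (star p q) (T - {e})"
      using ab connected_via_star_iff by blast
    then show False using min[OF e] by simp
  qed
  then have "T = {a, p + (b - p)}" using ab by auto
  moreover have "b - p < q" using ab by simp
  ultimately show "T \<in> {{i, p + j} | i j. i < p \<and> j < q}" using ab by blast
next
  fix T assume "T \<in> {{i, p + j} | i j. i < p \<and> j < q}"
  then obtain i j where ij: "i < p" "j < q" "T = {i, p + j}" by auto
  have T: "T \<subseteq> {..<p + q}" using ij by auto
  moreover have "connected_via (star p q) T"
    using ij connected_via_star_iff[OF T] by auto
  moreover have "\<not> connected_via (star p q) (T - {e})" if "e \<in> T" for e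
  proof -
    have "T - {e} \<subseteq> {..<p + q}" using T by auto
    from connected_via_star_iff[OF this] show ?thesis using ij that by auto
  qed
  ultimately show "T \<in> spanning_trees (star p q)" by (simp add: spanning_trees_def)
qed

text \<open>Iterating \<open>f\<close> from \<open>f y\<close> back to \<open>y\<close> exhibits a
  preimage of \<open>y\<close>; on a finite set surjectivity gives injectivity.\<close>

lemma bij_betw_if_transitive:
  assumes fin: "finite A" and into: "f ` A \<subseteq> A"
    and trans: "\<And>x y. x \<in> A \<Longrightarrow> y \<in> A \<Longrightarrow> \<exists>n. (f ^^ n) x = y"
  shows "bij_betw f A A"
proof -
  have iter: "(f ^^ n) x \<in> A" if "x \<in> A" for n x
    using that into by (induction n) auto
  have "y \<in> f ` A" if y: "y \<in> A" for y
  proof -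
    have "f y \<in> A" using into y by auto
    then obtain n where "(f ^^ n) (f y) = y" using trans y by blast
    then have "f ((f ^^ n) y) = y" by (simp add: funpow_swap1)
    then show ?thesis using iter[OF y, of n] by (metis imageI)
  qed
  then have "f ` A = A" using into by auto
  then show ?thesis using fin by (simp add: bij_betw_def eq_card_imp_inj_on)
qed

lemma srot_iterate:
  "x < p + q \<Longrightarrow> (srot p q 0 ^^ n) x = (x + n) mod (p + q)"
  "x < p \<Longrightarrow> (srot p q 1 ^^ n) x = (x + n) mod p"
  "x < q \<Longrightarrow> (srot p q 2 ^^ n) (p + x) = p + (x + n) mod q"
  by (induction n) (auto simp: srot_def mod_simps)

lemma ribbon_star:
  assumes "0 < p" "0 < q"
  shows "ribbon (star p q) (srot p q)"
proof -
  \<comment> \<open>Advancing \<open>m - x + y\<close> times leads from \<open>x\<close> to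
    \<open>y\<close>; subtracting from \<open>m\<close> first avoids truncation when
    \<open>y < x\<close>.\<close>
  have shift: "(x + (m - x + y)) mod m = y" if "x < m" "y < m" for x y m :: nat
    using that by simp
  have t0: "\<exists>n. (srot p q 0 ^^ n) x = y" if "x < p + q" "y < p + q" for x y
    using srot_iterate(1)[OF that(1), of "p + q - x + y"] shift[OF that] by metis
  have t1: "\<exists>n. (srot p q 1 ^^ n) x = y" if "x < p" "y < p" for x y
    using srot_iterate(2)[OF that(1), where q = q and n = "p - x + y"] shift[OF that] by metis
  have t2: "\<exists>n. (srot p q 2 ^^ n) x = y" if "x \<in> {p..<p + q}" "y \<in> {p..<p + q}" for x y
  proof -
    have xy: "x - p < q" "y - p < q" using that by auto
    have "(srot p q 2 ^^ (q - (x - p) + (y - p))) (p + (x - p)) = p + (y - p)"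
      unfolding srot_iterate(3)[OF xy(1)] shift[OF xy] ..
    then show ?thesis using that by auto
  qed
  have tr: "\<exists>n. (srot p q u ^^ n) x = y"
    if "u \<in> {0, 1, 2}" "incident (star p q) x u" "incident (star p q) y u" for u x y
    using that t0[of x y] t1[of x y] t2[of x y] by (auto simp: incident_star)
  have "graph (star p q)"
    using assms connected_via_star_iff[of "{..<p + q}" p q]
    by (auto simp: graph_def)
  moreover have "bij_betw (srot p q u) {e. incident (star p q) e u} {e. incident (star p q) e u}"
    if u: "u \<in> {0, 1, 2}" for u
  proof (rule bij_betw_if_transitive)
    show "finite {e. incident (star p q) e u}"
      by (rule finite_subset[of _ "{..<p + q}"]) (auto simp: incident_star)
    show "srot p q u ` {e. incident (star p q) e u} \<subseteq> {e. incident (star p q) e u}"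
      using u assms by (auto simp: incident_star srot_def)
  qed (use u tr in auto)
  ultimately show ?thesis using tr by (auto simp: ribbon_def)
qed

section \<open>The Laplacian and linear equivalence on stars\<close>

lemma fire_star:
  "fire (star p q) 0 0 = - int (p + q)" "fire (star p q) 0 1 = int p" "fire (star p q) 0 2 = int q"
  "fire (star p q) 1 0 = int p" "fire (star p q) 1 1 = - int p" "fire (star p q) 1 2 = 0"
  "fire (star p q) 2 0 = int q" "fire (star p q) 2 1 = 0" "fire (star p q) 2 2 = - int q"
proof -
  have e: "{e. incident (star p q) e 0 \<and> incident (star p q) e 1} = {..<p}"
    "{e. incident (star p q) e 1 \<and> incident (star p q) e 0} = {..<p}"
    "{e. incident (star p q) e 0 \<and> incident (star p q) e 2} = {p..<p + q}"
    "{e. incident (star p q) e 2 \<and> incident (star p q) e 0} = {p..<p + q}"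
    "{e. incident (star p q) e 1 \<and> incident (star p q) e 2} = {}"
    "{e. incident (star p q) e 2 \<and> incident (star p q) e 1} = {}"
    by (auto simp: incident_star)
  show "fire (star p q) 0 0 = - int (p + q)" "fire (star p q) 0 1 = int p"
    "fire (star p q) 0 2 = int q"
    "fire (star p q) 1 0 = int p" "fire (star p q) 1 1 = - int p" "fire (star p q) 1 2 = 0"
    "fire (star p q) 2 0 = int q" "fire (star p q) 2 1 = 0" "fire (star p q) 2 2 = - int q"
    unfolding fire_def vdeg_def e incident_star_0 incident_star_1 incident_star_2 by simp_all
qed

lemma fire_star_outside: "w \<notin> {0, 1, 2} \<Longrightarrow> u \<in> {0, 1, 2} \<Longrightarrow> fire (star p q) u w = 0"
  by (auto simp: fire_def incident_star)

text \<open>Firing according to \<open>f\<close> changes the leaves by \<open>p\<close> times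
  \<open>f 0 - f 1\<close> and \<open>q\<close> times \<open>f 0 - f 2\<close>. These two multiples
  can be chosen independently, and the total degree then determines the center.\<close>

lemma lin_equiv_star_iff:
  "lin_equiv (star p q) D D' \<longleftrightarrow>
     (\<forall>w. w \<notin> {0, 1, 2} \<longrightarrow> D' w = D w) \<and> D' 0 + D' 1 + D' 2 = D 0 + D 1 + D 2 \<and>
     int p dvd D' 1 - D 1 \<and> int q dvd D' 2 - D 2" (is "_ \<longleftrightarrow> ?R")
proof -
  have sum: "(\<Sum>u\<in>{0, 1, 2}. g u) = g 0 + g 1 + g 2" for g :: "nat \<Rightarrow> int"
    by simp
  have val: "(\<Sum>u\<in>{0, 1, 2}. f u * fire (star p q) u w) =
     (if w = 0 then int p * (f 1 - f 0) + int q * (f 2 - f 0) else if w = 1 then int p * (f 0 - f 1)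
      else if w = 2 then int q * (f 0 - f 2) else 0)" for f w
    unfolding sum
    \<comment> \<open>The simplifier turns the vertex \<open>1\<close> into \<open>Suc 0\<close>, so
      the table of firings is supplied in both forms.\<close>
    by (auto simp: fire_star fire_star[unfolded One_nat_def] fire_star_outside algebra_simps)
  show ?thesis
  proof
    assume "lin_equiv (star p q) D D'"
    then obtain f where "\<And>w. D' w = D w + (\<Sum>u\<in>{0, 1, 2}. f u * fire (star p q) u w)"
      by (auto simp: lin_equiv_def)
    then show ?R unfolding val by (simp add: algebra_simps)
  next
    assume R: ?R
    then obtain a b where ab: "D' 1 - D 1 = int p * a" "D' 2 - D 2 = int q * b"
      by (metis dvdE)
    \<comment> \<open>A constant firing vector changes nothing, so \<open>f 0 = 0\<close> may be
      taken; the leaf equations then force the other values.\<close>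
    define f where "f = (\<lambda>u::nat. if u = 1 then - a else if u = 2 then - b else 0)"
    have "D' w = D w + (\<Sum>u\<in>{0, 1, 2}. f u * fire (star p q) u w)" for w
      unfolding val using R ab by (auto simp: f_def)
    then show "lin_equiv (star p q) D D'" by (auto simp: lin_equiv_def)
  qed
qed

subsection \<open>Rotor routing\<close>

text \<open>The invariant \<open>I\<close> forces every halting run to end in \<open>R\<close>,
  whatever the representative and the order of moves, and the measure yields a halting run. Together
  these determine the definite description.\<close>

lemma rotor_torsor_eqI:
  fixes \<mu> :: "('v \<Rightarrow> int) \<times> ('v \<Rightarrow> 'e) \<Rightarrow> nat"
  assumes rep: "\<exists>D\<in>S. \<forall>u\<in>verts G - {v}. 0 \<le> D u"
    and ori: "\<exists>rot. oriented_to G T v rot"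
    and init: "\<And>D rot. D \<in> S \<Longrightarrow> \<forall>u\<in>verts G - {v}. 0 \<le> D u \<Longrightarrow>
                 oriented_to G T v rot \<Longrightarrow> I (D, rot)"
    and pres: "\<And>s s'. I s \<Longrightarrow> rr_step G rho v s s' \<Longrightarrow> I s'"
    and decr: "\<And>s s'. I s \<Longrightarrow> rr_step G rho v s s' \<Longrightarrow> \<mu> s' < \<mu> s"
    and nonneg: "\<And>s u. I s \<Longrightarrow> u \<in> verts G - {v} \<Longrightarrow> 0 \<le> fst s u"
    and final: "\<And>D rot. I (D, rot) \<Longrightarrow> \<forall>u\<in>verts G - {v}. D u = 0 \<Longrightarrow>
                  rot ` (verts G - {v}) = R"
  shows "rotor_torsor G rho v S T = R"
proof -
  have inv: "I s'" if "(rr_step G rho v)\<^sup>*\<^sup>* s s'" "I s" for s s'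
    using that by (induction rule: rtranclp_induct) (auto intro: pres)
  have halt: "\<exists>s'. (rr_step G rho v)\<^sup>*\<^sup>* s s' \<and> (\<forall>u\<in>verts G - {v}. fst s' u = 0)"
    if "I s" for s
    using that
  proof (induction s rule: measure_induct_rule[of \<mu>])
    case (less s)
    show ?case
    proof (cases "\<exists>u\<in>verts G - {v}. fst s u > 0")
      case True
      then obtain u where u: "u \<in> verts G - {v}" "fst s u > 0" by blast
      define rot' where "rot' = (snd s)(u := rho u (snd s u))"
      have "rr_step G rho v s
          (\<lambda>x. fst s x - (if x = u then 1 else 0) + (if x = other G (rot' u) u then 1 else 0), rot')"
        unfolding rr_step_def using u by (intro bexI[of _ u]) (simp_all add: rot'_def)
      then obtain s' where s': "rr_step G rho v s s'" ..
      show ?thesis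
        using less.IH[OF decr[OF less.prems s'] pres[OF less.prems s']] s'
        by (meson converse_rtranclp_into_rtranclp)
    next
      case False
      then have "\<forall>u\<in>verts G - {v}. fst s u = 0"
        using nonneg[OF less.prems] by (meson linorder_not_less order_antisym)
      then show ?thesis by blast
    qed
  qed
  show ?thesis
    unfolding rotor_torsor_def
  proof (rule the_equality)
    obtain D rot where D: "D \<in> S" "\<forall>u\<in>verts G - {v}. 0 \<le> D u" "oriented_to G T v rot"
      using rep ori by blast
    obtain s' where s': "(rr_step G rho v)\<^sup>*\<^sup>* (D, rot) s'" "\<forall>u\<in>verts G - {v}. fst s' u = 0"
      using halt[OF init[OF D]] by blast
    have "R = snd s' ` (verts G - {v})"
      using final[of "fst s'" "snd s'"] inv[OF s'(1) init[OF D]] s'(2) by simp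
    moreover have "(rr_step G rho v)\<^sup>*\<^sup>* (D, rot) (fst s', snd s')" using s'(1) by simp
    ultimately show "rr_result G rho v S T R"
      unfolding rr_result_def using D s'(2) by blast
  next
    fix T' assume "rr_result G rho v S T T'"
    then obtain D rot D' rot' where
      D: "D \<in> S" "\<forall>u\<in>verts G - {v}. 0 \<le> D u" "oriented_to G T v rot"
      and run: "(rr_step G rho v)\<^sup>*\<^sup>* (D, rot) (D', rot')" "\<forall>u\<in>verts G - {v}. D' u = 0"
      and T': "T' = rot' ` (verts G - {v})"
      unfolding rr_result_def by blast
    show "T' = R"
      using final[OF inv[OF run(1) init[OF D]] run(2)] T' by simp
  qed
qed

lemma lin_class_star_iff:
  assumes "D \<in> Div0 (star p q)"
  shows "D' \<in> lin_class (star p q) D \<longleftrightarrow>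
     D' \<in> Div0 (star p q) \<and> int p dvd D' 1 - D 1 \<and> int q dvd D' 2 - D 2"
proof -
  have D: "\<forall>w. w \<notin> {0, 1, 2} \<longrightarrow> D w = 0" "D 0 + D 1 + D 2 = 0"
    using assms by (simp_all add: Div0_def is_div_def)
  have sum: "(\<Sum>u\<in>verts (star p q). f u) = f 0 + f 1 + f 2" for f :: "nat \<Rightarrow> int"
    by simp
  show ?thesis
    unfolding lin_class_def lin_equiv_star_iff Div0_def is_div_def sum mem_Collect_eq
    unfolding verts_star using D by metis
qed

text \<open>Moving the basepoint to a leaf reverses the action on the edges at that leaf.\<close>

definition sg :: "nat \<Rightarrow> nat \<Rightarrow> int" where
  "sg v w = (if v = w then - 1 else 1)"

definition shifted_tree :: "nat \<Rightarrow> nat \<Rightarrow> nat \<Rightarrow> nat \<Rightarrow> int \<Rightarrow> int \<Rightarrow> nat set" where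
  "shifted_tree p q i j a b = {nat ((int i + a) mod int p), p + nat ((int j + b) mod int q)}"

section \<open>Single routing moves and their invariants\<close>

text \<open>The rotor advances before the chip leaves, so in case \<open>center\<close> the chip
  travels along the new edge \<open>r\<close>.\<close>

lemma rr_step_star_cases:
  assumes "rr_step (star p q) (srot p q) v (D, rot) s'"
  obtains
    (center) r where "v \<noteq> 0" "D 0 > 0" "r = srot p q 0 (rot 0)" "snd s' = rot(0 := r)"
      "fst s' 0 = D 0 - 1" "fst s' 1 = D 1 + (if r < p then 1 else 0)"
      "fst s' 2 = D 2 + (if r < p then 0 else 1)"
  | (leaf1) "v \<noteq> 1" "D 1 > 0" "snd s' = rot(1 := srot p q 1 (rot 1))"
      "fst s' 0 = D 0 + 1" "fst s' 1 = D 1 - 1" "fst s' 2 = D 2"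
  | (leaf2) "v \<noteq> 2" "D 2 > 0" "snd s' = rot(2 := srot p q 2 (rot 2))"
      "fst s' 0 = D 0 + 1" "fst s' 1 = D 1" "fst s' 2 = D 2 - 1"
proof -
  obtain u where u: "u \<in> {0, 1, 2} - {v}" "D u > 0" "snd s' = rot(u := srot p q u (rot u))"
    and "fst s' = (\<lambda>x. D x - (if x = u then 1 else 0)
                         + (if x = other (star p q) (snd s' u) u then 1 else 0))"
    using assms unfolding rr_step_def verts_star fst_conv snd_conv by blast
  then have D': "fst s' = (\<lambda>x. D x - (if x = u then 1 else 0)
                         + (if x = other (star p q) (srot p q u (rot u)) u then 1 else 0))"
    by simp
  from u(1) consider "u = 0" | "u = 1" | "u = 2" by auto
  then show thesis
  proof cases
    case 1 with u D' show thesis by (intro center) auto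
  next
    case 2 with u D' show thesis by (intro leaf1) auto
  next
    case 3 with u D' show thesis by (intro leaf2) auto
  qed
qed

text \<open>When the rotor at the center is at edge r, these are the numbers of edges to leaf 1 and to
  leaf 2 that it has passed, modulo p and q respectively.\<close>

definition turns1 :: "nat \<Rightarrow> nat \<Rightarrow> int" where
  "turns1 p r = (if r < p then int r + 1 else 0)"

definition turns2 :: "nat \<Rightarrow> nat \<Rightarrow> int" where
  "turns2 p r = (if r < p then 0 else int r + 1 - int p)"

lemma srot_0_less: "0 < p \<Longrightarrow> srot p q 0 r < p + q"
  and srot_1_less: "0 < p \<Longrightarrow> srot p q 1 r < p"
  and srot_2_bounds: "0 < q \<Longrightarrow> p \<le> srot p q 2 r \<and> srot p q 2 r < p + q"
  by (simp_all add: srot_def)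

lemma srot_0: "r < p + q \<Longrightarrow> srot p q 0 r = (if r + 1 < p + q then r + 1 else 0)"
  by (auto simp: srot_def) (metis Suc_lessI mod_self)

text \<open>The count grows by the number of chips sent to leaf 1, except when the rotor leaves the
  last edge \<open>p - 1\<close> of the block; there it falls short by exactly
  \<open>p\<close>.\<close>

lemma turns1_srot:
  assumes "0 < p" "r < p + q"
  shows "int p dvd turns1 p (srot p q 0 r) - turns1 p r - (if srot p q 0 r < p then 1 else 0)"
proof (cases "r + 1 = p")
  case True
  then have "turns1 p (srot p q 0 r) - turns1 p r - (if srot p q 0 r < p then 1 else 0) = - int p"
    using assms by (simp add: srot_0 turns1_def)
  then show ?thesis by simp
next
  case False
  then show ?thesis using assms by (auto simp: srot_0 turns1_def)
qed

lemma turns2_srot: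
  assumes "0 < p" "r < p + q"
  shows "int q dvd turns2 p (srot p q 0 r) - turns2 p r - (if srot p q 0 r < p then 0 else 1)"
proof -
  consider "r + 1 < p" | "r + 1 = p" "r + 1 < p + q" | "p < r + 1" "r + 1 < p + q"
    | "p \<le> r + 1" "r + 1 = p + q"
    using assms by linarith
  then show ?thesis
  proof cases
    \<comment> \<open>The rotor wraps around to edge 0 and the count for leaf 2 is reset; this is
      where the multiple of \<open>q\<close> arises.\<close>
    case 4
    then have "turns2 p (srot p q 0 r) - turns2 p r - (if srot p q 0 r < p then 0 else 1) = - int q"
      using assms by (auto simp: srot_0 turns2_def)
    then show ?thesis by simp
  qed (use assms in \<open>auto simp: srot_0 turns2_def\<close>)
qed

lemma leaf1_srot:
  assumes "r < p"
  shows "int p dvd int (srot p q 1 r) - int r - 1"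
proof (cases "r + 1 = p")
  case True
  then have "int (srot p q 1 r) - int r - 1 = - int p" by (auto simp: srot_def)
  then show ?thesis by simp
next
  case False
  then show ?thesis using assms by (simp add: srot_def)
qed

lemma leaf2_srot:
  assumes "p \<le> r" "r < p + q"
  shows "int q dvd int (srot p q 2 r) - int r - 1"
proof (cases "r + 1 = p + q")
  case True
  then have "r - p + 1 = q" using assms by linarith
  then have "int (srot p q 2 r) - int r - 1 = - int q" using True by (auto simp: srot_def)
  then show ?thesis by simp
next
  case False
  then have "r - p + 1 < q" using assms by linarith
  then show ?thesis using assms by (simp add: srot_def)
qed

text \<open>The chips at a leaf after all chips sent so far have been taken back along the edges their
  rotors have passed. A full turn of a rotor is a firing, so the classes modulo p and q do not change
  under routing.\<close>

definition phase1 :: "nat \<Rightarrow> nat \<Rightarrow> (nat \<Rightarrow> int) \<Rightarrow> (nat \<Rightarrow> nat) \<Rightarrow> int" where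
  "phase1 p v D rot =
     D 1 + (if v = 1 then 0 else int (rot 1)) - (if v = 0 then 0 else turns1 p (rot 0))"

definition phase2 :: "nat \<Rightarrow> nat \<Rightarrow> (nat \<Rightarrow> int) \<Rightarrow> (nat \<Rightarrow> nat) \<Rightarrow> int" where
  "phase2 p v D rot =
     D 2 + (if v = 2 then 0 else int (rot 2)) - (if v = 0 then 0 else turns2 p (rot 0))"

text \<open>The two clauses with a strict inequality say that a directed cycle of rotors always carries a
  chip; hence the final rotors form a tree.\<close>

definition rr_inv :: "nat \<Rightarrow> nat \<Rightarrow> nat \<Rightarrow> int \<Rightarrow> int \<Rightarrow> (nat \<Rightarrow> int) \<times> (nat \<Rightarrow> nat) \<Rightarrow> bool" where
  "rr_inv p q v a b s \<longleftrightarrow> (case s of (D, rot) \<Rightarrow>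
     D 0 + D 1 + D 2 = 0 \<and>
     (v \<noteq> 0 \<longrightarrow> 0 \<le> D 0 \<and> rot 0 < p + q) \<and>
     (v \<noteq> 1 \<longrightarrow> 0 \<le> D 1 \<and> rot 1 < p) \<and>
     (v \<noteq> 2 \<longrightarrow> 0 \<le> D 2 \<and> p \<le> rot 2 \<and> rot 2 < p + q) \<and>
     (v = 1 \<and> p \<le> rot 0 \<longrightarrow> 0 < D 0 + D 2) \<and>
     (v = 2 \<and> rot 0 < p \<longrightarrow> 0 < D 0 + D 1) \<and>
     int p dvd phase1 p v D rot - a \<and> int q dvd phase2 p v D rot - b)"

lemma dvd_diff_trans: "(k::int) dvd x - y \<Longrightarrow> k dvd y - z \<Longrightarrow> k dvd x - z"
  using dvd_add[of k "x - y" "y - z"] by simp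

lemma rr_inv_step:
  assumes pq: "0 < p" "0 < q" and inv: "rr_inv p q v a b s"
    and step: "rr_step (star p q) (srot p q) v s s'"
  shows "rr_inv p q v a b s'"
proof -
  obtain D rot where s: "s = (D, rot)" by (cases s)
  obtain D' rot' where s': "s' = (D', rot')" by (cases s')
  note I = inv[unfolded rr_inv_def s prod.case]
  \<comment> \<open>For each move only the changes of the two phases and the inequalities remain to
    be checked; congruence to \<open>a\<close> and \<open>b\<close> then carries over.\<close>
  have keep: ?thesis
    if d: "int p dvd phase1 p v D' rot' - phase1 p v D rot"
          "int q dvd phase2 p v D' rot' - phase2 p v D rot"
      and rest: "D' 0 + D' 1 + D' 2 = 0"
        "v \<noteq> 0 \<Longrightarrow> 0 \<le> D' 0 \<and> rot' 0 < p + q" "v \<noteq> 1 \<Longrightarrow> 0 \<le> D' 1 \<and> rot' 1 < p"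
        "v \<noteq> 2 \<Longrightarrow> 0 \<le> D' 2 \<and> p \<le> rot' 2 \<and> rot' 2 < p + q"
        "v = 1 \<Longrightarrow> p \<le> rot' 0 \<Longrightarrow> 0 < D' 0 + D' 2" "v = 2 \<Longrightarrow> rot' 0 < p \<Longrightarrow> 0 < D' 0 + D' 1"
    unfolding rr_inv_def s' prod.case
    using I rest dvd_diff_trans[OF d(1)] dvd_diff_trans[OF d(2)] by blast
  show ?thesis
    using step[unfolded s]
  proof (cases rule: rr_step_star_cases)
    case (center r)
    then have E: "D' 0 = D 0 - 1" "D' 1 = D 1 + (if r < p then 1 else 0)"
      "D' 2 = D 2 + (if r < p then 0 else 1)" "rot' 0 = r" "rot' 1 = rot 1" "rot' 2 = rot 2"
      by (simp_all add: s')
    have r0: "rot 0 < p + q" using I center(1) by simp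
    have "phase1 p v D' rot' - phase1 p v D rot
        = - (turns1 p r - turns1 p (rot 0) - (if r < p then 1 else 0))"
      unfolding phase1_def E using center(1) by simp
    moreover have "phase2 p v D' rot' - phase2 p v D rot
        = - (turns2 p r - turns2 p (rot 0) - (if r < p then 0 else 1))"
      unfolding phase2_def E using center(1) by simp
    ultimately have "int p dvd phase1 p v D' rot' - phase1 p v D rot"
      "int q dvd phase2 p v D' rot' - phase2 p v D rot"
      unfolding dvd_minus_iff center(3)
      using turns1_srot[OF pq(1) r0] turns2_srot[OF pq(1) r0] by (metis dvd_minus_iff)+
    then show ?thesis
      \<comment> \<open>If the center rotor now points to the leaf opposite a leaf sink, the chip
        just sent lies there, which gives the strict clause.\<close>
      by (rule keep) (use I E center(1-3) srot_0_less[OF pq(1)] in auto)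
  next
    case leaf1
    then have E: "D' 0 = D 0 + 1" "D' 1 = D 1 - 1" "D' 2 = D 2" "rot' 0 = rot 0"
      "rot' 1 = srot p q 1 (rot 1)" "rot' 2 = rot 2"
      by (simp_all add: s')
    have r1: "rot 1 < p" using I leaf1(1) by simp
    have "phase1 p v D' rot' - phase1 p v D rot = int (srot p q 1 (rot 1)) - int (rot 1) - 1"
      unfolding phase1_def E using leaf1(1) by simp
    then have "int p dvd phase1 p v D' rot' - phase1 p v D rot"
      using leaf1_srot[OF r1] by metis
    moreover have "int q dvd phase2 p v D' rot' - phase2 p v D rot"
      unfolding phase2_def E by simp
    ultimately show ?thesis
      by (rule keep) (use I E leaf1(1,2) srot_1_less[OF pq(1)] in auto)
  next
    case leaf2
    then have E: "D' 0 = D 0 + 1" "D' 1 = D 1" "D' 2 = D 2 - 1" "rot' 0 = rot 0"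
      "rot' 1 = rot 1" "rot' 2 = srot p q 2 (rot 2)"
      by (simp_all add: s')
    have r2: "p \<le> rot 2" "rot 2 < p + q" using I leaf2(1) by simp_all
    have "int p dvd phase1 p v D' rot' - phase1 p v D rot"
      unfolding phase1_def E by simp
    moreover have "phase2 p v D' rot' - phase2 p v D rot = int (srot p q 2 (rot 2)) - int (rot 2) - 1"
      unfolding phase2_def E using leaf2(1) by simp
    then have "int q dvd phase2 p v D' rot' - phase2 p v D rot"
      using leaf2_srot[OF r2] by metis
    ultimately show ?thesis
      by (rule keep) (use I E leaf2(1,2) srot_2_bounds[OF pq(2)] in auto)
  qed
qed

section \<open>Termination of rotor routing\<close>

text \<open>For a leaf sink \<open>v\<close>, this is the number of chips that the center, with its
  rotor at \<open>r\<close>, sends to the other leaf before its next chip enters the sink.\<close>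

definition sink_dist :: "nat \<Rightarrow> nat \<Rightarrow> nat \<Rightarrow> nat \<Rightarrow> int" where
  "sink_dist p q v r =
     (if v = 1 then if r < p then if r + 1 < p then 0 else int q else int p + int q - 1 - int r
      else if r < p then int p - 1 - int r else if r + 1 < p + q then 0 else int p)"

text \<open>For a leaf v, the other leaf is 3 - v. A step from the center to that leaf lowers
  \<open>sink_dist\<close> by one and adds one chip there; a step into the sink removes a chip, and its weight
  exceeds any increase of \<open>2 * sink_dist\<close>.\<close>

definition rr_measure :: "nat \<Rightarrow> nat \<Rightarrow> nat \<Rightarrow> (nat \<Rightarrow> int) \<times> (nat \<Rightarrow> nat) \<Rightarrow> int" where
  "rr_measure p q v s = (case s of (D, rot) \<Rightarrow>
     if v = 0 then D 1 + D 2
     else (2 * int (p + q) + 1) * (D 0 + D (3 - v)) + 2 * sink_dist p q v (rot 0) + D (3 - v))"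

lemma sink_dist_bounds:
  "0 < p \<Longrightarrow> r < p + q \<Longrightarrow> 0 \<le> sink_dist p q v r \<and> sink_dist p q v r \<le> int (p + q)"
  by (auto simp: sink_dist_def)

lemma rr_measure_nonneg:
  assumes "0 < p" "v \<in> {0, 1, 2}" "rr_inv p q v a b s"
  shows "0 \<le> rr_measure p q v s"
proof -
  obtain D rot where s: "s = (D, rot)" by (cases s)
  note I = assms(3)[unfolded rr_inv_def s prod.case]
  have b: "v \<noteq> 0 \<Longrightarrow> 0 \<le> sink_dist p q v (rot 0) \<and> sink_dist p q v (rot 0) \<le> int (p + q)"
    using sink_dist_bounds[OF assms(1)] I by simp
  from assms(2) consider "v = 0" | "v = 1" | "v = 2" by auto
  then show ?thesis using I b by cases (simp_all add: rr_measure_def s)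
qed

text \<open>With a leaf sink, a move of the other leaf keeps \<open>D 0 + D (3 - v)\<close> and the
  center rotor, and lowers only the last summand. With sink 0 every move takes a chip off a
  leaf.\<close>

lemma rr_measure_step:
  assumes pq: "0 < p" "0 < q" and v: "v \<in> {0, 1, 2}" and inv: "rr_inv p q v a b s"
    and step: "rr_step (star p q) (srot p q) v s s'"
  shows "rr_measure p q v s' < rr_measure p q v s"
proof -
  obtain D rot where s: "s = (D, rot)" by (cases s)
  obtain D' rot' where s': "s' = (D', rot')" by (cases s')
  note I = inv[unfolded rr_inv_def s prod.case]
  have b: "v \<noteq> 0 \<Longrightarrow> 0 \<le> sink_dist p q v (rot 0) \<and> sink_dist p q v (rot 0) \<le> int (p + q)"
    using sink_dist_bounds[OF pq(1)] I by simp
  have b': "0 \<le> sink_dist p q v (srot p q 0 (rot 0)) \<and> sink_dist p q v (srot p q 0 (rot 0)) \<le> int (p + q)"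
    using sink_dist_bounds[OF pq(1)] srot_0_less[OF pq(1)] by simp
  show ?thesis
    using step[unfolded s]
  proof (cases rule: rr_step_star_cases)
    case (center r)
    have r0: "rot 0 < p + q" using I center by simp
    have go: "sink_dist p q v r = sink_dist p q v (rot 0) - 1"
      if "v = 1 \<and> p \<le> r \<or> v = 2 \<and> r < p"
      using that r0 pq center by (auto simp: srot_0 sink_dist_def split: if_splits)
    have E: "D' 0 = D 0 - 1" "D' 1 = D 1 + (if r < p then 1 else 0)"
      "D' 2 = D 2 + (if r < p then 0 else 1)" "rot' 0 = r"
      using center by (simp_all add: s')
    have b'': "0 \<le> sink_dist p q v r" "sink_dist p q v r \<le> int (p + q)"
      using b' center(3) by simp_all
    consider "v = 1" "r < p" | "v = 1" "p \<le> r" | "v = 2" "r < p" | "v = 2" "p \<le> r"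
      using center(1) v by fastforce
    then show ?thesis
      \<comment> \<open>\<open>E[simplified]\<close> restates the equation for leaf 1 at
        \<open>Suc 0\<close>, the form to which \<open>3 - v\<close> reduces for
        \<open>v = 2\<close>.\<close>
      by cases (use b b'' go in \<open>auto simp: rr_measure_def s s' E E[simplified] algebra_simps\<close>)
  next
    case leaf1
    then have E: "D' 0 = D 0 + 1" "D' 1 = D 1 - 1" "D' 2 = D 2" "rot' 0 = rot 0"
      by (simp_all add: s')
    from v leaf1(1) consider "v = 0" | "v = 2" by auto
    then show ?thesis by cases (simp_all add: rr_measure_def s s' E algebra_simps E[simplified])
  next
    case leaf2
    then have E: "D' 0 = D 0 + 1" "D' 1 = D 1" "D' 2 = D 2 - 1" "rot' 0 = rot 0"
      by (simp_all add: s')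
    from v leaf2(1) consider "v = 0" | "v = 1" by auto
    then show ?thesis by cases (simp_all add: rr_measure_def s s' E algebra_simps E[simplified])
  qed
qed

section \<open>The rotor routing torsor as a translation of trees\<close>

lemma eq_nat_mod: "r < p \<Longrightarrow> int p dvd int r - x \<Longrightarrow> r = nat (x mod int p)"
  by (metis mod_eq_dvd_iff nat_int zmod_int mod_less)

text \<open>A leaf has one tree edge, so its rotor is forced; the center must point to the sink if
  that is a leaf.\<close>

lemma oriented_to_star_iff:
  assumes ij: "i < p" "j < q" and v: "v \<in> {0, 1, 2}"
  shows "oriented_to (star p q) {i, p + j} v rot \<longleftrightarrow>
     (v \<noteq> 0 \<longrightarrow> rot 0 = (if v = 1 then i else p + j)) \<and> (v \<noteq> 1 \<longrightarrow> rot 1 = i) \<and> (v \<noteq> 2 \<longrightarrow> rot 2 = p + j)"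
    (is "_ = ?R")
proof
  assume o: "oriented_to (star p q) {i, p + j} v rot"
  let ?f = "\<lambda>x. other (star p q) (rot x) x"
  have u: "rot u \<in> {i, p + j} \<and> incident (star p q) (rot u) u \<and> (\<exists>n. (?f ^^ n) u = v)"
    if "u \<in> {0, 1, 2}" "u \<noteq> v" for u
    using o that unfolding oriented_to_def verts_star by blast
  have r1: "rot 1 = i" if "v \<noteq> 1"
    using u[of 1] that ij by (auto simp: incident_star)
  have r2: "rot 2 = p + j" if "v \<noteq> 2"
    using u[of 2] that ij by (auto simp: incident_star)
  have "rot 0 = i" if vk: "v = 1"
  proof (rule ccontr)
    assume "rot 0 \<noteq> i"
    then have "rot 0 = p + j" using u[of 0] vk by auto
    \<comment> \<open>Following the rotors from the center would oscillate between 0 and 2 and never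
      reach the sink 1.\<close>
    then have "(?f ^^ n) 0 \<in> {0, 2}" for n
      by (induction n) auto
    moreover obtain n where "(?f ^^ n) 0 = v" using u[of 0] vk by auto
    ultimately show False using vk by (metis insertE numeral_One numeral_eq_iff singletonD zero_neq_one semiring_norm(85))
  qed
  moreover have "rot 0 = p + j" if vk: "v = 2"
  proof (rule ccontr)
    assume "rot 0 \<noteq> p + j"
    then have "rot 0 = i" using u[of 0] vk by auto
    then have "(?f ^^ n) 0 \<in> {0, 1}" for n
      using ij by (induction n) auto
    moreover obtain n where "(?f ^^ n) 0 = v" using u[of 0] vk by auto
    ultimately show False using vk by (metis insertE numeral_One numeral_eq_iff singletonD zero_neq_numeral semiring_norm(85))
  qed
  ultimately show ?R using r1 r2 v by auto
next
  assume R: ?R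
  let ?f = "\<lambda>x. other (star p q) (rot x) x"
  have n: "\<exists>n. (?f ^^ n) u = v" if "?f u = v \<or> ?f (?f u) = v" for u
    using that by (metis (no_types, lifting) funpow_0 funpow_simps_right(2) o_apply)
  show "oriented_to (star p q) {i, p + j} v rot"
    unfolding oriented_to_def verts_star
  proof (intro ballI conjI n)
    fix u assume u: "u \<in> {0, 1, 2} - {v}"
    show "rot u \<in> {i, p + j}" "incident (star p q) (rot u) u" "?f u = v \<or> ?f (?f u) = v"
      using u R ij v by (auto simp: incident_star)
  qed
qed

text \<open>Both leaf counts are reduced to residues. If the sink is a leaf, it lends a large
  multiple of its modulus to the center; the factor \<open>K = p + q\<close> suffices because the
  residues sum to less than \<open>p + q\<close>.\<close>

lemma lin_class_star_nonneg_rep: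
  assumes pq: "0 < p" "0 < q" and v: "v \<in> {0, 1, 2}" and D: "D \<in> Div0 (star p q)"
  shows "\<exists>D'\<in>lin_class (star p q) D. \<forall>u\<in>verts (star p q) - {v}. 0 \<le> D' u"
proof -
  define K where "K = int (p + q)"
  define x where "x = D 1 mod int p - (if v = 1 then int p * K else 0)"
  define y where "y = D 2 mod int q - (if v = 2 then int q * K else 0)"
  define D' where "D' = (\<lambda>u::nat. if u = 0 then - x - y else if u = 1 then x else if u = 2 then y else 0)"
  have m: "0 \<le> D 1 mod int p" "D 1 mod int p < int p" "0 \<le> D 2 mod int q" "D 2 mod int q < int q"
    using pq by simp_all
  have "K \<le> int p * K" "K \<le> int q * K"
    using pq by (simp_all add: K_def)
  then have K: "int p + int q \<le> int p * K" "int p + int q \<le> int q * K"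
    by (simp_all only: K_def of_nat_add)
  have "D' \<in> Div0 (star p q)"
    by (simp add: D'_def Div0_def is_div_def)
  moreover have "int p dvd D' 1 - D 1"
    unfolding mod_eq_dvd_iff[symmetric] by (simp add: D'_def x_def mod_simps mod_diff_right_eq[symmetric])
  moreover have "int q dvd D' 2 - D 2"
    unfolding mod_eq_dvd_iff[symmetric] by (simp add: D'_def y_def mod_simps mod_diff_right_eq[symmetric])
  ultimately have "D' \<in> lin_class (star p q) D"
    by (simp add: lin_class_star_iff[OF D])
  moreover have "0 \<le> D' u" if "u \<in> {0, 1, 2} - {v}" for u
  proof -
    have "v = 1 \<or> v = 2 \<Longrightarrow> 0 \<le> - x - y" "v \<noteq> 1 \<Longrightarrow> 0 \<le> x" "v \<noteq> 2 \<Longrightarrow> 0 \<le> y"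
      using m K by (auto simp: x_def y_def)
    then show ?thesis using that v by (auto simp: D'_def)
  qed
  ultimately show ?thesis by auto
qed

lemma rotor_torsor_star:
  assumes pq: "i < p" "j < q" and v: "v \<in> {0, 1, 2}" and D: "D \<in> Div0 (star p q)"
  shows "rotor_torsor (star p q) (srot p q) v (lin_class (star p q) D) {i, p + j} =
    shifted_tree p q i j (sg v 1 * D 1) (sg v 2 * D 2)"
proof -
  have pq0: "0 < p" "0 < q" using pq by auto
  \<comment> \<open>\<open>a\<close> and \<open>b\<close> are the initial phases, with the
    representative replaced by the congruent \<open>D\<close>. With sink 1 the center rotor starts
    at \<open>i\<close>, having passed \<open>i + 1\<close> edges; sink 2 is analogous.\<close>
  define a where "a = D 1 + (if v = 1 then - (int i + 1) else int i)"
  define b where "b = D 2 + (if v = 2 then - (int j + 1) else int p + int j)"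
  show ?thesis
  proof (rule rotor_torsor_eqI[where I = "rr_inv p q v a b" and \<mu> = "\<lambda>s. nat (rr_measure p q v s)"])
    show "\<exists>D'\<in>lin_class (star p q) D. \<forall>u\<in>verts (star p q) - {v}. 0 \<le> D' u"
      by (rule lin_class_star_nonneg_rep[OF pq0 v D])
    show "\<exists>rot. oriented_to (star p q) {i, p + j} v rot"
      unfolding oriented_to_star_iff[OF pq v]
      by (rule exI[of _ "\<lambda>u. if u = 1 then i else if u = 2 then p + j else if v = 1 then i else p + j"]) simp
  next
    fix D' rot
    assume D': "D' \<in> lin_class (star p q) D" "\<forall>u\<in>verts (star p q) - {v}. 0 \<le> D' u"
      and o: "oriented_to (star p q) {i, p + j} v rot"
    have E: "D' \<in> Div0 (star p q)" "int p dvd D' 1 - D 1" "int q dvd D' 2 - D 2"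
      using D'(1) lin_class_star_iff[OF D] by auto
    have sum: "D' 0 + D' 1 + D' 2 = 0" using E(1) by (simp add: Div0_def)
    have nn: "v \<noteq> 0 \<Longrightarrow> 0 \<le> D' 0" "v \<noteq> 1 \<Longrightarrow> 0 \<le> D' 1" "v \<noteq> 2 \<Longrightarrow> 0 \<le> D' 2"
      using D'(2) by auto
    have r: "v \<noteq> 0 \<Longrightarrow> rot 0 = (if v = 1 then i else p + j)" "v \<noteq> 1 \<Longrightarrow> rot 1 = i" "v \<noteq> 2 \<Longrightarrow> rot 2 = p + j"
      using o oriented_to_star_iff[OF pq v] by auto
    have "phase1 p v D' rot - a = D' 1 - D 1"
      using r v pq by (auto simp: phase1_def a_def turns1_def)
    moreover have "phase2 p v D' rot - b = D' 2 - D 2"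
      using r v pq by (auto simp: phase2_def b_def turns2_def)
    ultimately show "rr_inv p q v a b (D', rot)"
      unfolding rr_inv_def prod.case using sum nn r pq E(2,3) v by auto
  next
    fix s u assume "rr_inv p q v a b s" "u \<in> verts (star p q) - {v}"
    then show "0 \<le> fst s u" by (cases s) (auto simp: rr_inv_def)
  next
    fix D' rot
    assume I: "rr_inv p q v a b (D', rot)" and z: "\<forall>u\<in>verts (star p q) - {v}. D' u = 0"
    note I = I[unfolded rr_inv_def prod.case]
    \<comment> \<open>Total degree 0 empties the sink too, so the phases now depend on the rotors
      alone.\<close>
    have D0: "D' 0 = 0" "D' 1 = 0" "D' 2 = 0" using I z v by auto
    have d: "int p dvd phase1 p v D' rot - a" "int q dvd phase2 p v D' rot - b" using I by auto
    have "rot ` ({0, 1, 2} - {v}) = shifted_tree p q i j (sg v 1 * D 1) (sg v 2 * D 2)"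
    proof -
      consider "v = 0" | "v = 1" | "v = 2" using v by auto
      then show ?thesis
      proof cases
        case 1
        have b: "rot 1 < p" "p \<le> rot 2" "rot 2 < p + q" using I 1 by auto
        have "int p dvd int (rot 1) - (int i + D 1)"
          using d(1) 1 D0 by (simp add: phase1_def a_def algebra_simps)
        moreover have "int q dvd int (rot 2 - p) - (int j + D 2)"
          using d(2) 1 D0 b by (simp add: phase2_def b_def algebra_simps of_nat_diff)
        moreover have "rot 2 - p < q" using b by simp
        ultimately have "rot 1 = nat ((int i + D 1) mod int p)" "rot 2 - p = nat ((int j + D 2) mod int q)"
          using eq_nat_mod b(1) by auto
        moreover have "{0, 1, 2} - {v} = {1, 2}" using 1 by auto
        ultimately show ?thesis using 1 b(2) le_add_diff_inverse[OF b(2)]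
          by (simp add: shifted_tree_def sg_def insert_commute)
      next
        case 2
        \<comment> \<open>Without chips the strict clause excludes \<open>p \<le> rot 0\<close>, so
          the center points to the sink.\<close>
        have b: "rot 0 < p" "p \<le> rot 2" "rot 2 < p + q" using I 2 D0 by auto
        \<comment> \<open>The center rotor enters \<open>phase1\<close> with a minus sign; this is
          the source of the reversed sign in \<open>sg\<close>.\<close>
        have "int p dvd int (rot 0) - (int i - D 1)"
          using d(1) 2 D0 b dvd_minus_iff[of "int p" "int (rot 0) - (int i - D 1)"]
          by (simp add: phase1_def a_def turns1_def algebra_simps)
        moreover have "int q dvd int (rot 2 - p) - (int j + D 2)"
          using d(2) 2 D0 b by (simp add: phase2_def b_def turns2_def algebra_simps of_nat_diff)
        moreover have "rot 2 - p < q" using b by simp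
        ultimately have "rot 0 = nat ((int i - D 1) mod int p)" "rot 2 - p = nat ((int j + D 2) mod int q)"
          using eq_nat_mod b(1) by auto
        moreover have "{0, 1, 2} - {v} = {0, 2}" using 2 by auto
        ultimately show ?thesis using 2 b(2) le_add_diff_inverse[OF b(2)]
          by (simp add: shifted_tree_def sg_def insert_commute)
      next
        case 3
        have b: "rot 1 < p" "p \<le> rot 0" "rot 0 < p + q" using I 3 D0 by auto
        have "int p dvd int (rot 1) - (int i + D 1)"
          using d(1) 3 D0 b by (simp add: phase1_def a_def turns1_def algebra_simps)
        moreover have "int q dvd int (rot 0 - p) - (int j - D 2)"
          using d(2) 3 D0 b dvd_minus_iff[of "int q" "int (rot 0 - p) - (int j - D 2)"]
          by (simp add: phase2_def b_def turns2_def algebra_simps of_nat_diff)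
        moreover have "rot 0 - p < q" using b by simp
        ultimately have "rot 1 = nat ((int i + D 1) mod int p)" "rot 0 - p = nat ((int j - D 2) mod int q)"
          using eq_nat_mod b(1) by auto
        moreover have "{0, 1, 2} - {v} = {0, 1}" using 3 by auto
        ultimately show ?thesis using 3 b(2) le_add_diff_inverse[OF b(2)]
          by (simp add: shifted_tree_def sg_def insert_commute)
      qed
    qed
    then show "rot ` (verts (star p q) - {v}) = shifted_tree p q i j (sg v 1 * D 1) (sg v 2 * D 2)"
      by simp
  next
    fix s s' assume I: "rr_inv p q v a b s" and st: "rr_step (star p q) (srot p q) v s s'"
    show I': "rr_inv p q v a b s'"
      by (rule rr_inv_step[OF pq0 I st])
    show "nat (rr_measure p q v s') < nat (rr_measure p q v s)"
      using rr_measure_step[OF pq0 v I st] rr_measure_nonneg[OF pq0(1) v I'] by linarith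
  qed
qed

subsection \<open>Bernardi tours\<close>

primrec orbit_list :: "('a \<Rightarrow> 'a) \<Rightarrow> 'a \<Rightarrow> nat \<Rightarrow> 'a list" where
  "orbit_list f x 0 = []"
| "orbit_list f x (Suc n) = x # orbit_list f (f x) n"

lemma orbit_list_eq_map: "orbit_list f x n = map (\<lambda>k. (f ^^ k) x) [0..<n]"
proof (induction n arbitrary: x)
  case (Suc n)
  have "[0..<Suc n] = 0 # map Suc [0..<n]" by (simp add: map_Suc_upt upt_conv_Cons)
  then show ?case by (simp add: Suc funpow_swap1)
qed simp

text \<open>An executable form of the chip rule: \<open>P\<close> selects non-tree edges,
  \<open>opp\<close> gives the other half-edge, and \<open>seen\<close> records every half-edge
  already visited.\<close>

fun first_visits :: "('h \<Rightarrow> 'h) \<Rightarrow> ('h \<Rightarrow> bool) \<Rightarrow> 'h list \<Rightarrow> 'h list \<Rightarrow> 'h list" where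
  "first_visits opp P seen [] = []"
| "first_visits opp P seen (h # hs) =
     (if P h \<and> opp h \<notin> set seen then h # first_visits opp P (h # seen) hs
      else first_visits opp P (h # seen) hs)"

lemma length_filter_first_visits:
  "length (filter Q (first_visits opp P seen xs)) =
     card {i. i < length xs \<and> Q (xs ! i) \<and> P (xs ! i) \<and> opp (xs ! i) \<notin> set seen \<union> (!) xs ` {..<i}}"
proof (induction xs arbitrary: seen)
  case (Cons h hs)
  let ?A = "{i. i < length hs \<and> Q (hs ! i) \<and> P (hs ! i) \<and> opp (hs ! i) \<notin> set (h # seen) \<union> (!) hs ` {..<i}}"
  let ?B = "{i. i < length (h # hs) \<and> Q ((h # hs) ! i) \<and> P ((h # hs) ! i) \<and>
              opp ((h # hs) ! i) \<notin> set seen \<union> (!) (h # hs) ` {..<i}}"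
  let ?C = "if Q h \<and> P h \<and> opp h \<notin> set seen then {0} else {} :: nat set"
  have img: "(!) (h # hs) ` {..<Suc i} = insert h ((!) hs ` {..<i})" for i
    by (simp add: lessThan_Suc_eq_insert_0 image_image)
  \<comment> \<open>Index 0 is the head; every other index is a shifted index of the tail, whose
    prefix has absorbed the head into \<open>seen\<close>.\<close>
  have B: "?B = ?C \<union> Suc ` ?A"
  proof (rule set_eqI)
    fix i show "i \<in> ?B \<longleftrightarrow> i \<in> ?C \<union> Suc ` ?A"
      by (cases i) (auto simp: img)
  qed
  have "card ?B = card ?C + card ?A"
    unfolding B by (subst card_Un_disjoint) (auto simp: card_image)
  then show ?case using Cons.IH[of "h # seen"] by simp
qed simp

definition tree_step :: "nat \<Rightarrow> nat \<Rightarrow> nat \<Rightarrow> nat \<Rightarrow> nat \<times> nat \<Rightarrow> nat \<times> nat" where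
  "tree_step p q i j h =
     (let w = if fst h = i \<or> fst h = p + j then if snd h = 0 then if fst h < p then 1 else 2 else 0 else snd h
      in (srot p q w (fst h), w))"

text \<open>The length is the number of half-edges, the expected period of a Bernardi tour;
  \<open>tour_ok\<close> checks this period.\<close>

definition tour :: "nat \<Rightarrow> nat \<Rightarrow> nat \<Rightarrow> nat \<Rightarrow> nat \<Rightarrow> nat \<Rightarrow> (nat \<times> nat) list" where
  "tour p q i j v e0 = orbit_list (tree_step p q i j) (e0, v) (2 * (p + q))"

definition chips :: "nat \<Rightarrow> nat \<Rightarrow> nat \<Rightarrow> nat \<Rightarrow> nat \<Rightarrow> nat \<Rightarrow> nat list" where
  "chips p q i j v e0 = map snd (first_visits
     (\<lambda>h. (fst h, if snd h = 0 then if fst h < p then 1 else 2 else 0))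
     (\<lambda>h. fst h \<noteq> i \<and> fst h \<noteq> p + j) [] (tour p q i j v e0))"

text \<open>Besides the period, this checks that the Bernardi divisor has constant degree and that
  its leaf coordinates are affine in \<open>i\<close> and \<open>j\<close>, with slopes
  \<open>- sg v 1\<close> modulo \<open>p\<close> and \<open>- sg v 2\<close> modulo
  \<open>q\<close>. The tree with \<open>i = j = 0\<close> provides the constant terms.\<close>

definition tour_ok :: "nat \<Rightarrow> nat \<Rightarrow> nat \<Rightarrow> nat \<Rightarrow> nat \<Rightarrow> nat \<Rightarrow> bool" where
  "tour_ok p q i j v e0 \<longleftrightarrow>
     tree_step p q i j (last (tour p q i j v e0)) = (e0, v) \<and> (e0, v) \<notin> set (tl (tour p q i j v e0)) \<and>
     (let xs = chips p q i j v e0; ys = chips p q 0 0 v e0 in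
      length xs = length ys \<and> set xs \<subseteq> {0, 1, 2} \<and>
      (int (count_list xs 1) + sg v 1 * int i - int (count_list ys 1)) mod int p = 0 \<and>
      (int (count_list xs 2) + sg v 2 * int j - int (count_list ys 2)) mod int q = 0)"

lemma bstep_star: "bstep (star p q) (srot p q) {i, p + j} = tree_step p q i j"
  by (rule ext) (simp add: bstep_def tree_step_def Let_def other_star)

lemma count_list_map_snd: "count_list (map snd ys) u = length (filter (\<lambda>h. snd h = u) ys)"
  by (induction ys) auto

lemma bdiv_star:
  assumes ok: "tour_ok p q i j v e0" and pq: "0 < p"
  shows "bdiv (star p q) (srot p q) v e0 {i, p + j} u = int (count_list (chips p q i j v e0) u)"
proof -
  let ?f = "tree_step p q i j" and ?x = "(e0, v)" and ?N = "2 * (p + q)"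
  let ?t = "\<lambda>n. (?f ^^ n) ?x"
  have bt: "btour (star p q) (srot p q) {i, p + j} v e0 = ?t"
    by (rule ext) (simp add: btour_def bstep_star)
  have tour: "tour p q i j v e0 = map ?t [0..<?N]"
    by (simp add: tour_def orbit_list_eq_map)
  have N: "0 < ?N" using pq by simp
  have "last (map ?t [0..<?N]) = ?t (?N - 1)"
    using N by (simp add: last_map)
  then have "?f (?t (?N - 1)) = ?x"
    using ok by (simp add: tour_ok_def tour)
  then have close: "?t ?N = ?x"
    using N by (metis Suc_diff_1 comp_apply funpow.simps(2))
  have "tl (map ?t [0..<?N]) = map ?t [1..<?N]"
    by (simp add: map_tl[symmetric] tl_upt)
  then have "?x \<notin> set (map ?t [1..<?N])"
    using ok unfolding tour_ok_def tour by metis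
  then have first: "?t n \<noteq> ?x" if "0 < n" "n < ?N" for n
  proof -
    have "?t n \<in> set (map ?t [1..<?N])" using that by simp
    then show ?thesis using \<open>?x \<notin> _\<close> by metis
  qed
  \<comment> \<open>The tour closes after \<open>?N\<close> steps and the start does not recur
    earlier, so \<open>?N\<close> is the least period.\<close>
  have blen: "blen (star p q) (srot p q) {i, p + j} v e0 = ?N"
    unfolding blen_def bt
  proof (rule Least_equality)
    fix y assume "0 < y \<and> ?t y = ?x"
    then show "?N \<le> y" using first[of y] by (meson not_le)
  qed (use N close in blast)
  let ?o = "\<lambda>h. (fst h, if snd h = 0 then if fst h < p then 1 else 2 else 0 :: nat)"
  have "count_list (chips p q i j v e0) u = card {k. k < ?N \<and> snd (?t k) = u \<and>
      (fst (?t k) \<noteq> i \<and> fst (?t k) \<noteq> p + j) \<and> ?o (?t k) \<notin> ?t ` {..<k}}"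
  proof -
    have im: "(!) (map ?t [0..<?N]) ` {..<k} = ?t ` {..<k}" if "k < ?N" for k
      using that by (intro image_cong) auto
    show ?thesis
      unfolding chips_def count_list_map_snd length_filter_first_visits tour
      by (intro arg_cong[where f = card] Collect_cong conj_cong) (simp_all add: im)
  qed
  also have "\<dots> = card {k. k < ?N \<and> snd (?t k) = u \<and> fst (?t k) \<notin> {i, p + j} \<and>
      (fst (?t k), other (star p q) (fst (?t k)) u) \<notin> ?t ` {..<k}}"
    by (intro arg_cong[where f = card] Collect_cong conj_cong refl) (auto simp: other_star)
  finally show ?thesis
    unfolding bdiv_def bt blen by simp
qed

section \<open>Finite verification of the Bernardi tours\<close>

definition half_edge_list :: "nat \<Rightarrow> nat \<Rightarrow> (nat \<times> nat) list" where
  "half_edge_list p q =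
     map (\<lambda>e. (e, 0)) [0..<p + q] @ map (\<lambda>e. (e, 1)) [0..<p] @ map (\<lambda>e. (e, 2)) [p..<p + q]"

lemma half_edges_star: "half_edges (star p q) = set (half_edge_list p q)"
  unfolding half_edges_def half_edge_list_def by (auto simp: incident_star)

text \<open>Uncurried so that code_simp meets \<open>tour_ok\<close> at closed arguments only, never under a binder.\<close>

fun tour_ok_at :: "nat \<Rightarrow> nat \<Rightarrow> (nat \<times> nat) \<times> (nat \<times> nat) \<Rightarrow> bool" where
  "tour_ok_at p q ((i, j), (e0, v)) = tour_ok p q i j v e0"

definition tours_ok :: "nat \<Rightarrow> nat \<Rightarrow> bool" where
  "tours_ok p q \<longleftrightarrow> list_all (tour_ok_at p q)
     (List.product (List.product [0..<p] [0..<q]) (half_edge_list p q))"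

text \<open>Evaluation of 60 tours: 6 trees, each started at all 10 half-edges.\<close>

lemma tours_ok_3_2: "tours_ok 3 2"
  by code_simp

text \<open>Evaluation of 84 tours: 6 trees, each started at all 14 half-edges.\<close>

lemma tours_ok_6_1: "tours_ok 6 1"
  by code_simp

lemma tours_okD:
  assumes "tours_ok p q" "i < p" "j < q" "incident (star p q) e0 v"
  shows "tour_ok p q i j v e0"
proof -
  have "(e0, v) \<in> set (half_edge_list p q)"
    using assms(4) unfolding half_edges_star[symmetric] half_edges_def by simp
  then have "((i, j), (e0, v)) \<in> set (List.product (List.product [0..<p] [0..<q]) (half_edge_list p q))"
    using assms(2,3) by simp
  then have "tour_ok_at p q ((i, j), (e0, v))"
    using assms(1) unfolding tours_ok_def list_all_iff by blast
  then show ?thesis by simp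
qed

section \<open>The Bernardi torsor as a translation of trees\<close>

lemma sum_count_list_le_2:
  "set xs \<subseteq> {0, 1, 2::nat} \<Longrightarrow> count_list xs 0 + count_list xs 1 + count_list xs 2 = length xs"
  by (induction xs) auto

text \<open>Converts a change \<open>d\<close> of a leaf coordinate into a change of the tree index.
  Subtracting the two affine relations gives \<open>b' - b\<close> congruent to
  \<open>- s * (x' - x)\<close>, and \<open>s\<close> is its own inverse.\<close>

lemma dvd_cancel_sign:
  fixes k s b b' c d x x' :: int
  assumes "s = 1 \<or> s = - 1" "k dvd b + s * x - c" "k dvd b' + s * x' - c"
  shows "k dvd b' - (b + d) \<longleftrightarrow> k dvd x' - (x - s * d)"
proof -
  have "k dvd (b' + s * x' - c) - (b + s * x - c)" using assms by (simp only: dvd_diff)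
  then have *: "k dvd (b' - (b + d)) + (s * x' - s * x + d)" by (simp add: algebra_simps)
  have "k dvd b' - (b + d) \<longleftrightarrow> k dvd s * x' - s * x + d"
    using * by (metis dvd_add_left_iff dvd_add_right_iff)
  also have "\<dots> \<longleftrightarrow> k dvd x' - (x - s * d)"
    using assms(1) dvd_minus_iff[of k "x' - (x + d)"] by (auto simp: algebra_simps)
  finally show ?thesis .
qed

text \<open>Leaf coordinates determine the class of a divisor of given degree and are affine in the
  tree indices, so adding \<open>D\<close> translates the indices. The negative slopes produce the
  minus signs, and the result is the same for each starting edge \<open>e0\<close> at
  \<open>v\<close>.\<close>

lemma bernardi_torsor_star:
  assumes ok: "tours_ok p q" and ij: "i < p" "j < q" and e0: "incident (star p q) e0 v"
    and D: "D \<in> Div0 (star p q)"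
  shows "bernardi_torsor (star p q) (srot p q) v e0 (lin_class (star p q) D) {i, p + j} =
    shifted_tree p q i j (- (sg v 1 * D 1)) (- (sg v 2 * D 2))"
proof -
  define B where "B = (\<lambda>k l. bdiv (star p q) (srot p q) v e0 {k, p + l})"
  define C where "C = chips p q 0 0 v e0"
  have sgn: "sg v w = 1 \<or> sg v w = - 1" for w by (simp add: sg_def)
  have B: "(\<forall>w. w \<notin> {0, 1, 2} \<longrightarrow> B k l w = 0) \<and> B k l 0 + B k l 1 + B k l 2 = int (length C) \<and>
      int p dvd B k l 1 + sg v 1 * int k - int (count_list C 1) \<and>
      int q dvd B k l 2 + sg v 2 * int l - int (count_list C 2)"
    if kl: "k < p" "l < q" for k l
  proof -
    note t = tours_okD[OF ok kl e0]
    let ?xs = "chips p q k l v e0"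
    have Beq: "B k l w = int (count_list ?xs w)" for w
      unfolding B_def using bdiv_star[OF t] ij by simp
    have xs: "length ?xs = length C" "set ?xs \<subseteq> {0, 1, 2}"
      "(int (count_list ?xs 1) + sg v 1 * int k - int (count_list C 1)) mod int p = 0"
      "(int (count_list ?xs 2) + sg v 2 * int l - int (count_list C 2)) mod int q = 0"
      using t unfolding tour_ok_def Let_def C_def by blast+
    have "count_list ?xs w = 0" if "w \<notin> {0, 1, 2}" for w
      using xs(2) that by (intro count_notin) blast
    moreover have "B k l 0 + B k l 1 + B k l 2 = int (length C)"
      unfolding Beq using sum_count_list_le_2[OF xs(2)] xs(1) by linarith
    ultimately show ?thesis
      using xs(3,4) by (simp only: Beq dvd_eq_mod_eq_0) simp
  qed
  have equiv: "lin_equiv (star p q) (\<lambda>u. B i j u + D' u) (B k l) \<longleftrightarrow>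
      int p dvd int k - (int i - sg v 1 * D 1) \<and> int q dvd int l - (int j - sg v 2 * D 2)"
    if kl: "k < p" "l < q" and D': "D' \<in> lin_class (star p q) D" for k l D'
  proof -
    have D'0: "D' \<in> Div0 (star p q)" "int p dvd D' 1 - D 1" "int q dvd D' 2 - D 2"
      using D' lin_class_star_iff[OF D] by auto
    then have z: "\<forall>w. w \<notin> {0, 1, 2} \<longrightarrow> D' w = 0" "D' 0 + D' 1 + D' 2 = 0"
      by (simp_all add: Div0_def is_div_def)
    have "lin_equiv (star p q) (\<lambda>u. B i j u + D' u) (B k l) \<longleftrightarrow>
        int p dvd B k l 1 - (B i j 1 + D' 1) \<and> int q dvd B k l 2 - (B i j 2 + D' 2)"
      unfolding lin_equiv_star_iff using B[OF kl] B[OF ij] z by simp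
    \<comment> \<open>Passing from the representative \<open>D'\<close> to \<open>D\<close> changes
      the leaf counts by multiples of \<open>p\<close> and \<open>q\<close>.\<close>
    also have "\<dots> \<longleftrightarrow> int p dvd B k l 1 - (B i j 1 + D 1) \<and> int q dvd B k l 2 - (B i j 2 + D 2)"
    proof -
      have "int p dvd B k l 1 - (B i j 1 + D' 1) \<longleftrightarrow> int p dvd B k l 1 - (B i j 1 + D 1)"
        using dvd_add_left_iff[OF D'0(2), of "B k l 1 - (B i j 1 + D' 1)"] by (simp add: algebra_simps)
      moreover have "int q dvd B k l 2 - (B i j 2 + D' 2) \<longleftrightarrow> int q dvd B k l 2 - (B i j 2 + D 2)"
        using dvd_add_left_iff[OF D'0(3), of "B k l 2 - (B i j 2 + D' 2)"] by (simp add: algebra_simps)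
      ultimately show ?thesis by blast
    qed
    also have "\<dots> \<longleftrightarrow> int p dvd int k - (int i - sg v 1 * D 1) \<and> int q dvd int l - (int j - sg v 2 * D 2)"
      using dvd_cancel_sign[OF sgn, where c = "int (count_list C 1)" and k = "int p" and x = "int i"
          and b = "B i j 1" and x' = "int k" and b' = "B k l 1" and d = "D 1"]
        dvd_cancel_sign[OF sgn, where c = "int (count_list C 2)" and k = "int q" and x = "int j"
          and b = "B i j 2" and x' = "int l" and b' = "B k l 2" and d = "D 2"]
        B[OF kl] B[OF ij] by (elim conjE) simp
    finally show ?thesis .
  qed
  define k where "k = nat ((int i - sg v 1 * D 1) mod int p)"
  define l where "l = nat ((int j - sg v 2 * D 2) mod int q)"
  have kl: "k < p" "l < q"
    using ij by (simp_all add: k_def l_def nat_less_iff)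
  have R: "shifted_tree p q i j (- (sg v 1 * D 1)) (- (sg v 2 * D 2)) = {k, p + l}"
    by (simp add: shifted_tree_def k_def l_def)
  show ?thesis
    unfolding bernardi_torsor_def R
  proof (rule the_equality)
    have "int k mod int p = (int i - sg v 1 * D 1) mod int p" "int l mod int q = (int j - sg v 2 * D 2) mod int q"
      using ij by (simp_all add: k_def l_def)
    then have d: "int p dvd int k - (int i - sg v 1 * D 1)" "int q dvd int l - (int j - sg v 2 * D 2)"
      by (simp_all only: mod_eq_dvd_iff)
    have DD: "D \<in> lin_class (star p q) D" using lin_class_star_iff[OF D] D by simp
    then show "{k, p + l} \<in> spanning_trees (star p q) \<and> (\<exists>D'\<in>lin_class (star p q) D.
        lin_equiv (star p q) (\<lambda>u. bdiv (star p q) (srot p q) v e0 {i, p + j} u + D' u)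
          (bdiv (star p q) (srot p q) v e0 {k, p + l}))"
      using equiv[OF kl DD] d kl unfolding spanning_trees_star B_def by blast
  next
    fix T' assume "T' \<in> spanning_trees (star p q) \<and> (\<exists>D'\<in>lin_class (star p q) D.
        lin_equiv (star p q) (\<lambda>u. bdiv (star p q) (srot p q) v e0 {i, p + j} u + D' u)
          (bdiv (star p q) (srot p q) v e0 T'))"
    then obtain k' l' D' where T': "T' = {k', p + l'}" "k' < p" "l' < q"
      and D': "D' \<in> lin_class (star p q) D" "lin_equiv (star p q) (\<lambda>u. B i j u + D' u) (B k' l')"
      unfolding spanning_trees_star B_def by auto
    then have "k' = k" "l' = l"
      using equiv[OF T'(2,3) D'(1)] eq_nat_mod unfolding k_def l_def by blast+
    then show "T' = {k, p + l}" using T'(1) by simp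
  qed
qed

subsection \<open>Genus\<close>

text \<open>The hypothesis on \<open>rotate1\<close> says that \<open>f\<close> sends each entry to
  its cyclic successor, so iterating \<open>f\<close> runs through the whole list.\<close>

lemma cyclic_list_orbit:
  assumes rot: "map f xs = rotate1 xs" and x: "x \<in> set xs"
  shows "{y. \<exists>n. (f ^^ n) x = y} = set xs"
proof -
  have len: "0 < length xs" using x by (cases xs) auto
  have step: "f (xs ! k) = xs ! (Suc k mod length xs)" if "k < length xs" for k
    using that arg_cong[OF rot, of "\<lambda>l. l ! k"] by (simp add: nth_rotate1)
  have iter: "(f ^^ n) (xs ! k) = xs ! ((k + n) mod length xs)" if "k < length xs" for n k
    using that len by (induction n) (simp_all add: step mod_Suc_eq)
  obtain k where k: "k < length xs" "x = xs ! k" using x by (auto simp: in_set_conv_nth)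
  have "y \<in> set xs" if "(f ^^ n) x = y" for n y
    using that iter[OF k(1)] k len by auto
  moreover have "\<exists>n. (f ^^ n) x = xs ! l" if "l < length xs" for l
    using iter[OF k(1), of "length xs - k + l"] that k by auto
  ultimately show ?thesis by (auto simp: in_set_conv_nth)
qed

text \<open>Two disjoint cyclic lists covering the half-edges certify that the face relation has
  exactly two classes.\<close>

lemma cyc_eq_2I:
  assumes xs: "map (face_next G rho) xs = rotate1 xs" "xs \<noteq> []"
    and ys: "map (face_next G rho) ys = rotate1 ys" "ys \<noteq> []"
    and H: "half_edges G = set xs \<union> set ys" and disj: "set xs \<inter> set ys = {}"
  shows "cyc G rho = 2"
proof -
  let ?r = "{(h, h'). h \<in> half_edges G \<and> h' \<in> half_edges G \<and> (\<exists>n. (face_next G rho ^^ n) h = h')}"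
  have cls: "?r `` {h} = set zs"
    if "map (face_next G rho) zs = rotate1 zs" "h \<in> set zs" "set zs \<subseteq> half_edges G" for h zs
    using cyclic_list_orbit[OF that(1,2)] that(2,3) by auto
  have x: "?r `` {h} = set xs" if "h \<in> set xs" for h
    using cls[OF xs(1) that] H by simp
  have y: "?r `` {h} = set ys" if "h \<in> set ys" for h
    using cls[OF ys(1) that] H by simp
  have "half_edges G // ?r = (\<lambda>h. ?r `` {h}) ` (set xs \<union> set ys)"
    unfolding quotient_def H by blast
  also have "\<dots> = {set xs, set ys}"
    using x y xs(2) ys(2) by (auto simp: image_Un image_constant_conv cong: image_cong)
  finally have "half_edges G // ?r = {set xs, set ys}" .
  moreover have "set xs \<noteq> set ys" using disj xs(2) by auto
  ultimately show ?thesis by (simp add: cyc_def)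
qed

lemma genus_3_2: "genus (star 3 2) (srot 3 2) = 1"
proof -
  have "cyc (star 3 2) (srot 3 2) = 2"
  proof (rule cyc_eq_2I)
    \<comment> \<open>The two faces, a pair \<open>(e, u)\<close> meaning that \<open>u\<close> is
      entered along \<open>e\<close>. With 3 vertices and 5 edges, twice the genus is 2 - 3 + 5 - 2
      = 2.\<close>
    let ?xs = "[(0, 0), (1, 1), (2, 0), (3, 2), (4, 0), (0, 1), (1, 0), (2, 1)] :: (nat \<times> nat) list"
    let ?ys = "[(3, 0), (4, 2)] :: (nat \<times> nat) list"
    show "map (face_next (star 3 2) (srot 3 2)) ?xs = rotate1 ?xs"
      "map (face_next (star 3 2) (srot 3 2)) ?ys = rotate1 ?ys"
      by code_simp+
    show "half_edges (star 3 2) = set ?xs \<union> set ?ys"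
      unfolding half_edges_star by code_simp
  qed auto
  then show ?thesis by (simp add: genus_def)
qed

lemma genus_6_1: "genus (star 6 1) (srot 6 1) = 2"
proof -
  have "cyc (star 6 1) (srot 6 1) = 2"
  proof (rule cyc_eq_2I)
    \<comment> \<open>Here there are 3 vertices, 7 edges and 2 faces, so twice the genus is 2 - 3 +
      7 - 2 = 4.\<close>
    let ?xs = "[(0, 0), (1, 1), (2, 0), (3, 1), (4, 0), (5, 1)] :: (nat \<times> nat) list"
    let ?ys = "[(1, 0), (2, 1), (3, 0), (4, 1), (5, 0), (6, 2), (6, 0), (0, 1)] :: (nat \<times> nat) list"
    show "map (face_next (star 6 1) (srot 6 1)) ?xs = rotate1 ?xs"
      "map (face_next (star 6 1) (srot 6 1)) ?ys = rotate1 ?ys"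
      by code_simp+
    show "half_edges (star 6 1) = set ?xs \<union> set ?ys"
      unfolding half_edges_star by code_simp
  qed auto
  then show ?thesis by (simp add: genus_def)
qed

subsection \<open>Equivariance\<close>

lemma Div0_star_iff:
  "D \<in> Div0 (star p q) \<longleftrightarrow> (\<forall>u. u \<notin> {0, 1, 2} \<longrightarrow> D u = 0) \<and> D 0 + D 1 + D 2 = 0"
  by (simp add: Div0_def is_div_def add.assoc)

lemma lin_class_star_eq:
  assumes "D \<in> Div0 (star p q)" "D' \<in> lin_class (star p q) D"
  shows "lin_class (star p q) D' = lin_class (star p q) D"
proof -
  have D': "D' \<in> Div0 (star p q)" "int p dvd D' 1 - D 1" "int q dvd D' 2 - D 2"
    using assms lin_class_star_iff by auto
  have "int p dvd E 1 - D' 1 \<longleftrightarrow> int p dvd E 1 - D 1" for E :: "nat \<Rightarrow> int"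
    using dvd_add_left_iff[OF D'(2), of "E 1 - D' 1"] by simp
  moreover have "int q dvd E 2 - D' 2 \<longleftrightarrow> int q dvd E 2 - D 2" for E :: "nat \<Rightarrow> int"
    using dvd_add_left_iff[OF D'(3), of "E 2 - D' 2"] by simp
  ultimately show ?thesis
    using lin_class_star_iff[OF assms(1)] lin_class_star_iff[OF D'(1)] by blast
qed

text \<open>Degree-zero divisors on the leaves are the multiples of their difference, so a
  representative amounts to one integer \<open>m\<close> solving two congruences.\<close>

lemma Pic0_star_supported:
  assumes crt: "\<And>a b. \<exists>m. int p dvd - m - a \<and> int q dvd m - b" and S: "S \<in> Pic0 (star p q)"
  shows "\<exists>D\<in>S. supported_in {1, 2} D"
proof -
  obtain D where D: "D \<in> Div0 (star p q)" "S = lin_class (star p q) D"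
    using S by (auto simp: Pic0_def)
  obtain m where m: "int p dvd - m - D 1" "int q dvd m - D 2" using crt by blast
  define E where "E = (\<lambda>u::nat. if u = 1 then - m else if u = 2 then m else 0)"
  have "E \<in> Div0 (star p q)" "int p dvd E 1 - D 1" "int q dvd E 2 - D 2"
    using m by (auto simp: E_def Div0_star_iff)
  then have "E \<in> S" using D lin_class_star_iff by blast
  moreover have "supported_in {1, 2} E" by (simp add: supported_in_def E_def)
  ultimately show ?thesis by blast
qed

lemma property1_stars: "property1 (star 3 2) (star 6 1) {1, 2}"
proof -
  have "\<exists>m. int 3 dvd - m - a \<and> int 2 dvd m - b" for a b
  proof (intro exI conjI)
    \<comment> \<open>The witness is congruent to \<open>- a\<close> modulo 3 and to
      \<open>b\<close> modulo 2.\<close>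
    show "int 3 dvd - (2 * a + 3 * b) - a" "int 2 dvd (2 * a + 3 * b) - b" by (simp_all; presburger)+
  qed
  moreover have "\<exists>m. int 6 dvd - m - a \<and> int 1 dvd m - b" for a b
    by (rule exI[of _ "- a"]) simp
  ultimately show ?thesis
    unfolding property1_def using Pic0_star_supported[of 3 2] Pic0_star_supported[of 6 1] by blast
qed

lemma property2_stars: "property2 (star 3 2) (star 6 1) {1, 2}"
  unfolding property2_def
proof (intro ballI impI)
  fix D D' assume D: "D \<in> Div0 (star 3 2)" "D' \<in> Div0 (star 3 2)"
    "supported_in {1, 2} D" "supported_in {1, 2} D'"
  then have "D 0 = 0" "D' 0 = 0" by (simp_all add: supported_in_def)
  then have e: "D 2 = - D 1" "D' 2 = - D' 1" and o: "\<forall>w. w \<notin> {0, 1, 2} \<longrightarrow> D' w = D w"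
    using D(1,2) by (auto simp: Div0_star_iff)
  \<comment> \<open>Both leaf differences are the same up to sign, so equivalence in
    \<open>star 3 2\<close> is divisibility by 6, as in \<open>star 6 1\<close>.\<close>
  have "3 dvd x \<and> 2 dvd - x \<longleftrightarrow> 6 dvd x" for x :: int by presburger
  from this[of "D' 1 - D 1"] show "lin_equiv (star 3 2) D D' \<longleftrightarrow> lin_equiv (star 6 1) D D'"
    unfolding lin_equiv_star_iff using e o by simp
qed

text \<open>Chinese remainder theorem: \<open>4 * i + 3 * j\<close> is i modulo 3 and j modulo 2.\<close>

definition tree_map :: "nat set \<Rightarrow> nat set" where
  "tree_map T = {(\<Sum>e\<in>T. if e < 3 then 4 * e else 3 * (e - 3)) mod 6, 6}"

text \<open>The condition \<open>i < 3\<close> keeps the two edges in different branches of the sum.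
  The form \<open>6 + 0\<close> matches the description of the trees of
  \<open>star 6 1\<close>.\<close>

lemma tree_map_tree: "i < 3 \<Longrightarrow> tree_map {i, 3 + j} = {(4 * i + 3 * j) mod 6, 6 + 0}"
  by (simp add: tree_map_def)

lemma bij_tree_map: "bij_betw tree_map (spanning_trees (star 3 2)) (spanning_trees (star 6 1))"
proof -
  have "inj_on tree_map (spanning_trees (star 3 2))"
  proof (rule inj_onI)
    fix T T' assume "T \<in> spanning_trees (star 3 2)" "T' \<in> spanning_trees (star 3 2)"
      and eq: "tree_map T = tree_map T'"
    then obtain i j i' j' where T: "T = {i, 3 + j}" "i < 3" "j < 2" "T' = {i', 3 + j'}" "i' < 3" "j' < 2"
      by (auto simp: spanning_trees_star)
    have "(4 * i + 3 * j) mod 6 < 6" "(4 * i' + 3 * j') mod 6 < 6" by simp_all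
    then have "(4 * i + 3 * j) mod 6 = (4 * i' + 3 * j') mod 6"
      using eq T by (auto simp: tree_map_tree doubleton_eq_iff)
    moreover have "i \<in> {0, 1, 2}" "i' \<in> {0, 1, 2}" "j \<in> {0, 1}" "j' \<in> {0, 1}" using T by auto
    ultimately have "i = i' \<and> j = j'" by (elim insertE emptyE) simp_all
    then show "T = T'" using T by simp
  qed
  moreover have "tree_map ` spanning_trees (star 3 2) = spanning_trees (star 6 1)"
  proof (intro equalityI subsetI)
    fix T assume "T \<in> tree_map ` spanning_trees (star 3 2)"
    then obtain i j where "i < 3" "T = tree_map {i, 3 + j}" by (auto simp: spanning_trees_star)
    then show "T \<in> spanning_trees (star 6 1)"
      unfolding spanning_trees_star using tree_map_tree by fastforce
  next
    fix T assume "T \<in> spanning_trees (star 6 1)"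
    then obtain k where k: "k < 6" "T = {k, 6 + 0}" by (auto simp: spanning_trees_star)
    have "k \<in> {0, 1, 2, 3, 4, 5}" using k(1) by auto
    \<comment> \<open>The inverse takes both residues of \<open>k\<close>: the sum is congruent to
      \<open>7 * k\<close>, hence to \<open>k\<close>, modulo 6.\<close>
    then have "(4 * (k mod 3) + 3 * (k mod 2)) mod 6 = k" by (elim insertE emptyE) simp_all
    then have "T = tree_map {k mod 3, 3 + k mod 2}" using k by (simp add: tree_map_tree)
    moreover have "{k mod 3, 3 + k mod 2} \<in> spanning_trees (star 3 2)"
      unfolding spanning_trees_star by fastforce
    ultimately show "T \<in> tree_map ` spanning_trees (star 3 2)" by blast
  qed
  ultimately show ?thesis by (simp add: bij_betw_def)
qed

text \<open>The shift becomes \<open>4 * x + 3 * y\<close>, which is congruent to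
  \<open>7 * x\<close>, hence to \<open>x\<close>, modulo 6 because \<open>x\<close> and
  \<open>y\<close> have equal parity. Modulo 1 every shift \<open>z\<close> is trivial.\<close>

lemma tree_map_shifted_tree:
  assumes "i < 3" "j < 2" "2 dvd y - x"
  shows "tree_map (shifted_tree 3 2 i j x y) = shifted_tree 6 1 ((4 * i + 3 * j) mod 6) 0 x z"
proof -
  define i' where "i' = nat ((int i + x) mod 3)"
  define j' where "j' = nat ((int j + y) mod 2)"
  have i': "int i' = (int i + x) mod 3" and j': "int j' = (int j + y) mod 2"
    by (simp_all add: i'_def j'_def)
  have "i' < 3" by (simp add: i'_def nat_less_iff)
  then have L: "tree_map (shifted_tree 3 2 i j x y) = {(4 * i' + 3 * j') mod 6, 6}"
    using tree_map_tree[of i' j'] by (simp add: shifted_tree_def i'_def j'_def)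
  have "(4 * ((a + x) mod 3) + 3 * ((b + y) mod 2)) mod 6 = (4 * a + 3 * b + x) mod 6" for a b :: int
  proof -
    obtain t where "y = x + 2 * t" using assms(3) by (metis dvdE diff_eq_eq add.commute)
    then have "4 * ((a + x) mod 3) + 3 * ((b + y) mod 2)
        = (4 * a + 3 * b + x) + 6 * (x - 2 * ((a + x) div 3) + t - (b + y) div 2)"
      by (simp add: minus_div_mult_eq_mod[symmetric] algebra_simps)
    then show ?thesis by (metis mod_mult_self2)
  qed
  then have "int ((4 * i' + 3 * j') mod 6) = (int ((4 * i + 3 * j) mod 6) + x) mod 6"
    by (simp add: i' j' zmod_int mod_simps)
  then have "(4 * i' + 3 * j') mod 6 = nat ((int ((4 * i + 3 * j) mod 6) + x) mod 6)"
    by (metis nat_int)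
  then show ?thesis unfolding L by (simp add: shifted_tree_def)
qed

text \<open>Treats both torsors at once: \<open>s = 1\<close> is rotor routing and
  \<open>s = - 1\<close> is Bernardi.\<close>

lemma shift_actions_equivariant:
  assumes s: "s = 1 \<or> s = - 1"
    and A: "\<And>D i j. D \<in> Div0 (star 3 2) \<Longrightarrow> i < 3 \<Longrightarrow> j < 2 \<Longrightarrow>
      A (lin_class (star 3 2) D) {i, 3 + j} = shifted_tree 3 2 i j (s * (sg v 1 * D 1)) (s * (sg v 2 * D 2))"
    and A': "\<And>D i j. D \<in> Div0 (star 6 1) \<Longrightarrow> i < 6 \<Longrightarrow> j < 1 \<Longrightarrow>
      A' (lin_class (star 6 1) D) {i, 6 + j} = shifted_tree 6 1 i j (s * (sg v 1 * D 1)) (s * (sg v 2 * D 2))"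
    and S: "S \<in> Pic0 (star 3 2)" and T: "T \<in> spanning_trees (star 3 2)"
  shows "tree_map (A S T) = A' (gamma_hat (star 3 2) (star 6 1) {1, 2} S) (tree_map T)"
proof -
  define D where "D = (SOME D. D \<in> S \<and> supported_in {1, 2} D)"
  have "\<exists>D. D \<in> S \<and> supported_in {1, 2} D"
    using property1_stars S unfolding property1_def by blast
  then have DS: "D \<in> S" "supported_in {1, 2} D"
    unfolding D_def by (metis (mono_tags, lifting) someI_ex)+
  obtain D0 where D0: "D0 \<in> Div0 (star 3 2)" "S = lin_class (star 3 2) D0"
    using S by (auto simp: Pic0_def)
  have S_eq: "S = lin_class (star 3 2) D" and D: "D \<in> Div0 (star 3 2)"
    using lin_class_star_eq[OF D0(1)] lin_class_star_iff[OF D0(1)] DS(1) D0(2) by auto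
  then have D': "D \<in> Div0 (star 6 1)" by (simp add: Div0_star_iff)
  have D2: "D 2 = - D 1" using D DS(2) by (simp add: Div0_star_iff supported_in_def)
  obtain i j where ij: "T = {i, 3 + j}" "i < 3" "j < 2" using T by (auto simp: spanning_trees_star)
  \<comment> \<open>Since \<open>D 2 = - D 1\<close>, each shift is \<open>D 1\<close> up to sign,
    so the parities agree for every basepoint.\<close>
  have par: "2 dvd s * (sg v 2 * D 2) - s * (sg v 1 * D 1)"
    using s unfolding D2 sg_def by auto
  have "tree_map (A S T) =
      shifted_tree 6 1 ((4 * i + 3 * j) mod 6) 0 (s * (sg v 1 * D 1)) (s * (sg v 2 * D 2))"
    unfolding S_eq ij(1) A[OF D ij(2,3)] using tree_map_shifted_tree[OF ij(2,3) par] .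
  also have "\<dots> = A' (lin_class (star 6 1) D) (tree_map T)"
    unfolding ij(1) tree_map_tree[OF ij(2)] by (rule A'[OF D', symmetric]) simp_all
  finally show ?thesis unfolding gamma_hat_def D_def[symmetric] .
qed

theorem theorem1p6:
  shows "(\<exists>(G :: (nat, nat) mgraph) rho (G' :: (nat, nat) mgraph) rho' Vgen
            (\<phi> :: nat set \<Rightarrow> nat set).
      ribbon G rho \<and> ribbon G' rho' \<and> genus G rho \<noteq> genus G' rho' \<and>
      verts G = verts G' \<and> Vgen \<subseteq> verts G \<and>
      property1 G G' Vgen \<and> property2 G G' Vgen \<and>
      bij_betw \<phi> (spanning_trees G) (spanning_trees G') \<and>
      (\<forall>v\<in>verts G. \<forall>S\<in>Pic0 G. \<forall>T\<in>spanning_trees G.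
         \<phi> (rotor_torsor G rho v S T) =
         rotor_torsor G' rho' v (gamma_hat G G' Vgen S) (\<phi> T)))
   \<and>
   (\<exists>(G :: (nat, nat) mgraph) rho (G' :: (nat, nat) mgraph) rho' Vgen
            (\<phi> :: nat set \<Rightarrow> nat set).
      ribbon G rho \<and> ribbon G' rho' \<and> genus G rho \<noteq> genus G' rho' \<and>
      verts G = verts G' \<and> Vgen \<subseteq> verts G \<and>
      property1 G G' Vgen \<and> property2 G G' Vgen \<and>
      bij_betw \<phi> (spanning_trees G) (spanning_trees G') \<and>
      (\<forall>v\<in>verts G. \<forall>e0 e0'. incident G e0 v \<longrightarrow> incident G' e0' v \<longrightarrow>
         (\<forall>S\<in>Pic0 G. \<forall>T\<in>spanning_trees G.
           \<phi> (bernardi_torsor G rho v e0 S T) =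
           bernardi_torsor G' rho' v e0' (gamma_hat G G' Vgen S) (\<phi> T))))"
proof -
  have common: "ribbon (star 3 2) (srot 3 2)" "ribbon (star 6 1) (srot 6 1)"
    "genus (star 3 2) (srot 3 2) \<noteq> genus (star 6 1) (srot 6 1)"
    "verts (star 3 2) = verts (star 6 1)" "{1, 2} \<subseteq> verts (star 3 2)"
    \<comment> \<open>Simplifying \<open>genus_6_1\<close> matches the \<open>Suc 0\<close> that
      replaces the parameter 1 in the goal.\<close>
    by (simp_all add: ribbon_star genus_3_2 genus_6_1[simplified])
  have rotor: "tree_map (rotor_torsor (star 3 2) (srot 3 2) v S T) =
      rotor_torsor (star 6 1) (srot 6 1) v (gamma_hat (star 3 2) (star 6 1) {1, 2} S) (tree_map T)"
    if "v \<in> verts (star 3 2)" "S \<in> Pic0 (star 3 2)" "T \<in> spanning_trees (star 3 2)" for v S T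
  proof (rule shift_actions_equivariant[where s = 1 and v = v])
    have v: "v \<in> {0, 1, 2}" using that(1) by simp
    show "rotor_torsor (star 3 2) (srot 3 2) v (lin_class (star 3 2) D) {i, 3 + j} =
        shifted_tree 3 2 i j (1 * (sg v 1 * D 1)) (1 * (sg v 2 * D 2))"
      if "D \<in> Div0 (star 3 2)" "i < 3" "j < 2" for D i j
      unfolding mult_1 by (rule rotor_torsor_star[OF that(2,3) v that(1)])
    show "rotor_torsor (star 6 1) (srot 6 1) v (lin_class (star 6 1) D) {i, 6 + j} =
        shifted_tree 6 1 i j (1 * (sg v 1 * D 1)) (1 * (sg v 2 * D 2))"
      if "D \<in> Div0 (star 6 1)" "i < 6" "j < 1" for D i j
      unfolding mult_1 by (rule rotor_torsor_star[OF that(2,3) v that(1)])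
  qed (use that in simp_all)
  have bernardi: "tree_map (bernardi_torsor (star 3 2) (srot 3 2) v e0 S T) =
      bernardi_torsor (star 6 1) (srot 6 1) v e0' (gamma_hat (star 3 2) (star 6 1) {1, 2} S) (tree_map T)"
    if "incident (star 3 2) e0 v" "incident (star 6 1) e0' v"
      "S \<in> Pic0 (star 3 2)" "T \<in> spanning_trees (star 3 2)" for v e0 e0' S T
  proof (rule shift_actions_equivariant[where s = "- 1" and v = v])
    show "bernardi_torsor (star 3 2) (srot 3 2) v e0 (lin_class (star 3 2) D) {i, 3 + j} =
        shifted_tree 3 2 i j (- 1 * (sg v 1 * D 1)) (- 1 * (sg v 2 * D 2))"
      if "D \<in> Div0 (star 3 2)" "i < 3" "j < 2" for D i j
      unfolding mult_minus1
      by (rule bernardi_torsor_star[OF tours_ok_3_2 that(2,3) \<open>incident (star 3 2) e0 v\<close> that(1)])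
    show "bernardi_torsor (star 6 1) (srot 6 1) v e0' (lin_class (star 6 1) D) {i, 6 + j} =
        shifted_tree 6 1 i j (- 1 * (sg v 1 * D 1)) (- 1 * (sg v 2 * D 2))"
      if "D \<in> Div0 (star 6 1)" "i < 6" "j < 1" for D i j
      unfolding mult_minus1
      by (rule bernardi_torsor_star[OF tours_ok_6_1 that(2,3) \<open>incident (star 6 1) e0' v\<close> that(1)])
  qed (use that in simp_all)
  show ?thesis
    by (intro conjI; intro exI[of _ "star 3 2"] exI[of _ "srot 3 2"] exI[of _ "star 6 1"]
        exI[of _ "srot 6 1"] exI[of _ "{1, 2}"] exI[of _ tree_map] conjI ballI allI impI
        common property1_stars property2_stars bij_tree_map rotor bernardi)
qed

end
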